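(* Let $r>0$. The mean distance $M_1$ between two uniformly and independently distributed random points in the regular octagon $\mathcal{P}_{8,r}$ satisfies \begin{align*} \frac{M_1}{r}={}&\frac{4\sqrt2\,\pi}{3}+2\sqrt{2-\sqrt2}\,\Bigg[\frac15+\frac{13\sqrt2}{120}-\left(\frac1{20}+\frac{\sqrt2}{60}+\frac{2\pi}{3}\right)\sqrt{2+\sqrt2}\\ &-\frac1{48}\left(14+\frac{91\sqrt2}{10}\right)\ln\left(2+\sqrt2\right)+\frac1{48}\left(1+\frac{7\sqrt2}{10}\right)\ln\left(2-\sqrt2\right)\\ &+\frac1{20}\left(\frac13-\frac{\sqrt2}{4}\right)\ln\left(2+\sqrt{2+\sqrt2}\right)+\frac1{40}\left(21+\frac{29\sqrt2}{2}\right)\ln\left(2+\sqrt{2-\sqrt2}\right)\Bigg]. \end{align*}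
   Context: $\mathcal{P}_{n,r}$ is the (filled) regular polygon with $n$ sides whose circumscribed circle has radius $r$. The mean distance $M_1$ is the expected Euclidean distance between two points chosen independently and uniformly (w.r.t. area) from the polygon. *)

theory Defs
  imports "HOL-Analysis.Analysis"
begin

text \<open>
  The plane is \<^typ>\<open>real \<times> real\<close>, whose \<^const>\<open>dist\<close> is Euclidean. A regular polygon is
  determined by its number of sides and its circumradius only up to congruence, so the centre
  \<open>c\<close> and the direction \<open>\<theta>\<close> of one vertex are kept as parameters.
\<close>

definition regular_polygon :: "nat \<Rightarrow> real \<Rightarrow> real \<times> real \<Rightarrow> real \<Rightarrow> (real \<times> real) set" where
  "regular_polygon n r c \<theta> =
     convex hull ((\<lambda>k. c + (r * cos (\<theta> + 2 * pi * real k / real n),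
                            r * sin (\<theta> + 2 * pi * real k / real n))) ` {..<n})"

text \<open>The product measure is the joint law of two independent uniform points of \<open>S\<close>.\<close>

definition mean_distance :: "(real \<times> real) set \<Rightarrow> real" where
  "mean_distance S =
     (\<integral>p. dist (fst p) (snd p) \<partial>(uniform_measure lborel S \<Otimes>\<^sub>M uniform_measure lborel S))"

end

(* The product measure reduces the mean distance to the integral of |p - q| over pairs of points of
   the polygon, a quantity that behaves well under similarities, so one may take the octagon with
   apothem 1, vertices (+-1, +-t), (+-t, +-1), t = tan (pi/8) = sqrt 2 - 1. By its rotational symmetry
   it is enough to integrate over the pairs whose connecting line has slope m in (-t, t). Parametrise
   the pairs by that line y = m x + b and the two abscissae; the Jacobian and the distance together
   contribute sqrt (1 + m^2) (x' - x)^2, so a line that cuts out the abscissae [l, u] contributes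
   sqrt (1 + m^2) (u - l)^4 / 6. For m in [0, t], u - l is a piecewise linear function of b, and the
   integral over b collapses to 16/15 (5 t + 2 - 3 m - (1 + m)^-3 - t^5 (1 - m)^-3). The remaining
   integral over m is elementary. *)

theory Submission
  imports Defs
begin

section \<open>Similarities of the plane\<close>

text \<open>All integrals stay nonnegative extended ones until an antiderivative evaluates them:
  Fubini and substitution then need measurability only, and finiteness comes for free. The price is
  that every evaluated piece must be shown nonnegative and that overlaps in null sets are treated
  almost everywhere. The bound \<open>\<tau> = tan (pi / 8)\<close> on the slope does two things.
  The double sector of slopes below \<open>\<tau>\<close> is invariant under v -> -v, so four turns
  by pi/4 exhaust all directions. And a line of slope 0 < m < \<open>\<tau>\<close>, moved upwards
  from the centre, meets the vertices (1, \<open>\<tau>\<close>), (-1, \<open>\<tau>\<close>),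
  (\<open>\<tau>\<close>, 1), (-\<open>\<tau>\<close>, 1) in this order, because
  \<open>\<tau>\<close> is just the slope of the diagonal joining the second to the third; hence one
  formula in m serves for the whole range. With apothem 1 the vertices have coordinates in Q(sqrt
  2), and cos(pi/8) enters only as a scale factor. The terms with pi in the closed form cancel,
  since sqrt(2 - sqrt 2) * sqrt(2 + sqrt 2) = sqrt 2; the multiples of ln 2 hidden in its logarithms
  cancel as well.\<close>

definition rot :: "real \<Rightarrow> real \<Rightarrow> real \<times> real \<Rightarrow> real \<times> real" where
  "rot a b p = (a * fst p - b * snd p, b * fst p + a * snd p)"

lemma rot_measurable [measurable]: "rot a b \<in> borel \<rightarrow>\<^sub>M borel"
  unfolding rot_def by (simp flip: borel_prod)

lemma nn_integral_lborel_pair: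
  fixes f :: "real \<times> real \<Rightarrow> ennreal"
  assumes "f \<in> borel_measurable borel"
  shows "(\<integral>\<^sup>+p. f p \<partial>lborel) = (\<integral>\<^sup>+x. \<integral>\<^sup>+y. f (x, y) \<partial>lborel \<partial>lborel)"
    and "(\<integral>\<^sup>+p. f p \<partial>lborel) = (\<integral>\<^sup>+y. \<integral>\<^sup>+x. f (x, y) \<partial>lborel \<partial>lborel)"
proof -
  have f: "f \<in> borel_measurable (lborel \<Otimes>\<^sub>M lborel)"
    using assms by (simp add: lborel_prod)
  show "(\<integral>\<^sup>+p. f p \<partial>lborel) = (\<integral>\<^sup>+x. \<integral>\<^sup>+y. f (x, y) \<partial>lborel \<partial>lborel)"
    using lborel.nn_integral_fst[OF f] by (simp add: lborel_prod)
  show "(\<integral>\<^sup>+p. f p \<partial>lborel) = (\<integral>\<^sup>+y. \<integral>\<^sup>+x. f (x, y) \<partial>lborel \<partial>lborel)"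
    using lborel_pair.nn_integral_snd[of f] f by (simp add: lborel_prod)
qed

text \<open>By Fubini a shear merely translates each inner integral. The two shears are the raw
  material for rotations.\<close>

lemma nn_integral_shear:
  fixes f :: "real \<times> real \<Rightarrow> ennreal"
  assumes [measurable]: "f \<in> borel_measurable borel"
  shows "(\<integral>\<^sup>+p. f (fst p + k * snd p, snd p) \<partial>lborel) = (\<integral>\<^sup>+p. f p \<partial>lborel)"
    and "(\<integral>\<^sup>+p. f (fst p, snd p + k * fst p) \<partial>lborel) = (\<integral>\<^sup>+p. f p \<partial>lborel)"
proof -
  have [measurable]: "f \<in> borel_measurable (borel \<Otimes>\<^sub>M borel)"
    by (simp add: borel_prod)
  have m1: "(\<lambda>p. f (fst p + k * snd p, snd p)) \<in> borel_measurable borel"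
    and m2: "(\<lambda>p. f (fst p, snd p + k * fst p)) \<in> borel_measurable borel"
    unfolding borel_prod[symmetric] by measurable
  have "(\<integral>\<^sup>+x. f (x + k * y, y) \<partial>lborel) = (\<integral>\<^sup>+x. f (x, y) \<partial>lborel)" for y
    using nn_integral_real_affine[of "\<lambda>x. f (x, y)" 1 "k * y"] by (simp add: add.commute)
  then show "(\<integral>\<^sup>+p. f (fst p + k * snd p, snd p) \<partial>lborel) = (\<integral>\<^sup>+p. f p \<partial>lborel)"
    using m1 assms by (simp add: nn_integral_lborel_pair(2))
  have "(\<integral>\<^sup>+y. f (x, y + k * x) \<partial>lborel) = (\<integral>\<^sup>+y. f (x, y) \<partial>lborel)" for x
    using nn_integral_real_affine[of "\<lambda>y. f (x, y)" 1 "k * x"] by (simp add: add.commute)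
  then show "(\<integral>\<^sup>+p. f (fst p, snd p + k * fst p) \<partial>lborel) = (\<integral>\<^sup>+p. f p \<partial>lborel)"
    using m2 assms by (simp add: nn_integral_lborel_pair(1))
qed

text \<open>Each coordinate contributes a factor |s|. Negative \<open>s\<close> matters:
  \<open>s = -1\<close> supplies the half-turn.\<close>

lemma nn_integral_affine_pair:
  fixes f :: "real \<times> real \<Rightarrow> ennreal"
  assumes [measurable]: "f \<in> borel_measurable borel" and s: "s \<noteq> 0"
  shows "(\<integral>\<^sup>+p. f p \<partial>lborel) = ennreal (s\<^sup>2) * (\<integral>\<^sup>+p. f (c + s *\<^sub>R p) \<partial>lborel)"
proof -
  have [measurable]: "f \<in> borel_measurable (borel \<Otimes>\<^sub>M borel)"
    by (simp add: borel_prod)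
  have m: "(\<lambda>p. f (fst c + s * fst p, snd c + s * snd p)) \<in> borel_measurable borel"
    unfolding borel_prod[symmetric] by measurable
  have "(\<integral>\<^sup>+p. f p \<partial>lborel) = (\<integral>\<^sup>+x. \<integral>\<^sup>+y. f (x, y) \<partial>lborel \<partial>lborel)"
    by (simp add: nn_integral_lborel_pair(1))
  also have "\<dots> = (\<integral>\<^sup>+x. ennreal \<bar>s\<bar> * \<integral>\<^sup>+y. f (x, snd c + s * y) \<partial>lborel \<partial>lborel)"
    by (intro nn_integral_cong nn_integral_real_affine s) measurable
  also have "\<dots> = ennreal \<bar>s\<bar> * (\<integral>\<^sup>+x. ennreal \<bar>s\<bar> * \<integral>\<^sup>+y. f (fst c + s * x, snd c + s * y) \<partial>lborel \<partial>lborel)"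
    by (intro nn_integral_real_affine s) measurable
  also have "\<dots> = ennreal (s\<^sup>2) * (\<integral>\<^sup>+x. \<integral>\<^sup>+y. f (fst c + s * x, snd c + s * y) \<partial>lborel \<partial>lborel)"
    by (subst nn_integral_cmult)
       (simp_all flip: ennreal_mult' mult.assoc add: power2_eq_square)
  also have "(\<integral>\<^sup>+x. \<integral>\<^sup>+y. f (fst c + s * x, snd c + s * y) \<partial>lborel \<partial>lborel) = (\<integral>\<^sup>+p. f (c + s *\<^sub>R p) \<partial>lborel)"
    by (subst nn_integral_lborel_pair(1)) (use m in \<open>simp_all add: plus_prod_def scaleR_prod_def\<close>)
  finally show ?thesis .
qed

text \<open>A rotation other than \<open>\<plusminus>1\<close> is a product of three shears.\<close>

lemma nn_integral_rot:
  fixes f :: "real \<times> real \<Rightarrow> ennreal"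
  assumes f: "f \<in> borel_measurable borel" and ab: "a\<^sup>2 + b\<^sup>2 = 1"
  shows "(\<integral>\<^sup>+p. f (rot a b p) \<partial>lborel) = (\<integral>\<^sup>+p. f p \<partial>lborel)"
proof (cases "b = 0")
  case True
  then have "a = 1 \<or> a = -1" using ab by (simp add: power2_eq_1_iff)
  moreover have "rot 1 0 = (\<lambda>p. p)" "rot (-1) 0 = (\<lambda>p. - p)"
    by (auto simp: rot_def)
  ultimately show ?thesis
    using True nn_integral_affine_pair[OF f, of "-1" 0] by auto
next
  case False
  \<comment> \<open>For a = cos \<alpha> and b = sin \<alpha> this is -tan(\<alpha>/2): shear
    horizontally by \<open>k\<close>, vertically by \<open>b\<close>, horizontally by
    \<open>k\<close> again. The value is forced by k b = a - 1.\<close>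
  define k where "k = (a - 1) / b"
  have kb: "k * b = a - 1" and ka: "k * (1 + a) = - b"
    using False ab by (simp_all add: k_def field_simps power2_eq_square)
  have R: "rot a b p = (let x = fst p + k * snd p; y = snd p + b * x in (x + k * y, y))" for p
  proof -
    have "a * x - b * y = x + k * y + k * (y + b * (x + k * y))"
      "b * x + a * y = y + b * (x + k * y)" for x y :: real
      using kb ka by algebra+
    then show ?thesis by (simp add: rot_def Let_def)
  qed
  have [measurable]: "f \<in> borel_measurable (borel \<Otimes>\<^sub>M borel)"
    using f by (simp add: borel_prod)
  have g1: "(\<lambda>p. f (fst p + k * snd p, snd p)) \<in> borel_measurable borel"
    and g2: "(\<lambda>p. f (fst p + k * (snd p + b * fst p), snd p + b * fst p)) \<in> borel_measurable borel"
    unfolding borel_prod[symmetric] by measurable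
  show ?thesis
    unfolding R Let_def
    using nn_integral_shear(1)[OF g2, of k] nn_integral_shear(2)[OF g1, of b] nn_integral_shear(1)[OF f, of k]
    by simp
qed

lemma nn_integral_similarity:
  fixes f :: "real \<times> real \<Rightarrow> ennreal"
  assumes f: "f \<in> borel_measurable borel" and s: "s \<noteq> 0" and ab: "a\<^sup>2 + b\<^sup>2 = 1"
  shows "(\<integral>\<^sup>+p. f p \<partial>lborel) = ennreal (s\<^sup>2) * (\<integral>\<^sup>+p. f (c + s *\<^sub>R rot a b p) \<partial>lborel)"
proof -
  have "(\<lambda>p. f (c + s *\<^sub>R p)) \<in> borel_measurable borel"
    using f by measurable
  then show ?thesis
    using nn_integral_affine_pair[OF f s] nn_integral_rot[OF _ ab, of "\<lambda>p. f (c + s *\<^sub>R p)"] by simp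
qed

section \<open>The energy of pairs of points\<close>

text \<open>The weight sees only the difference vector, so translations drop out. Leaving it general
  covers both the distance and its restriction to a sector of directions.\<close>

definition pair_energy :: "(real \<times> real \<Rightarrow> ennreal) \<Rightarrow> (real \<times> real) set \<Rightarrow> ennreal" where
  "pair_energy w S = (\<integral>\<^sup>+p. \<integral>\<^sup>+q. indicator S p * indicator S q * w (q - p) \<partial>lborel \<partial>lborel)"

lemma rot_diff: "rot a b p - rot a b q = rot a b (p - q)"
  by (simp add: rot_def algebra_simps)

lemma norm_rot: "a\<^sup>2 + b\<^sup>2 = 1 \<Longrightarrow> norm (rot a b p) = norm p"
proof -
  assume ab: "a\<^sup>2 + b\<^sup>2 = 1"
  have "(a * x - b * y)\<^sup>2 + (b * x + a * y)\<^sup>2 = (a\<^sup>2 + b\<^sup>2) * (x\<^sup>2 + y\<^sup>2)" for x y :: real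
    by algebra
  then show ?thesis by (simp add: norm_prod_def rot_def ab)
qed

text \<open>Both points are substituted, \<open>q\<close> for fixed \<open>p\<close> and then
  \<open>p\<close>; each contributes s^2, and \<open>c\<close> cancels in the difference.\<close>

lemma pair_energy_similarity:
  assumes [measurable]: "w \<in> borel_measurable borel" "S \<in> sets borel"
    and s: "s \<noteq> 0" and ab: "a\<^sup>2 + b\<^sup>2 = 1"
  shows "pair_energy w S = ennreal (s ^ 4) *
    pair_energy (\<lambda>v. w (s *\<^sub>R rot a b v)) {p. c + s *\<^sub>R rot a b p \<in> S}"
proof -
  let ?T = "\<lambda>p. c + s *\<^sub>R rot a b p" and ?S = "{p. c + s *\<^sub>R rot a b p \<in> S}"
  have m [measurable]: "?S \<in> sets borel"
    by measurable
  have *: "(\<integral>\<^sup>+q. indicator S p * indicator S q * w (q - p) \<partial>lborel) =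
    ennreal (s\<^sup>2) * (\<integral>\<^sup>+q. indicator S p * indicator S (?T q) * w (?T q - p) \<partial>lborel)" for p
    by (rule nn_integral_similarity[OF _ s ab]) measurable
  have "pair_energy w S = ennreal (s\<^sup>2) * (\<integral>\<^sup>+p. \<integral>\<^sup>+q. indicator S (?T p) * indicator S q * w (q - ?T p) \<partial>lborel \<partial>lborel)"
    unfolding pair_energy_def by (rule nn_integral_similarity[OF _ s ab]) measurable
  also have "\<dots> = ennreal (s\<^sup>2) * (\<integral>\<^sup>+p. ennreal (s\<^sup>2) * (\<integral>\<^sup>+q. indicator S (?T p) * indicator S (?T q) * w (?T q - ?T p) \<partial>lborel) \<partial>lborel)"
    by (simp only: *)
  also have "\<dots> = ennreal (s\<^sup>2) * (ennreal (s\<^sup>2) * (\<integral>\<^sup>+p. \<integral>\<^sup>+q. indicator S (?T p) * indicator S (?T q) * w (?T q - ?T p) \<partial>lborel \<partial>lborel))"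
    by (subst nn_integral_cmult) simp_all
  also have "(\<lambda>p q. indicator S (?T p) * indicator S (?T q) * w (?T q - ?T p)) =
      (\<lambda>p q. indicator ?S p * indicator ?S q * w (s *\<^sub>R rot a b (q - p)))"
    by (simp add: indicator_def flip: scaleR_diff_right rot_diff)
  finally show ?thesis
    by (simp add: pair_energy_def flip: mult.assoc ennreal_mult' power_add)
qed

text \<open>Each of the two uniform laws contributes one division by \<open>A\<close>. The distance
  being nonnegative, the integral in \<open>mean_distance\<close> is \<open>enn2real\<close> of the
  extended one, which is finite here.\<close>

lemma mean_distance_eq_pair_energy:
  assumes [measurable]: "S \<in> sets borel" and A: "emeasure lborel S = ennreal A" "A > 0"
    and I: "pair_energy (\<lambda>v. ennreal (norm v)) S = ennreal I" "I \<ge> 0"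
  shows "mean_distance S = I / A\<^sup>2"
proof -
  define M where "M = uniform_measure lborel S"
  have [measurable_cong, simp]: "sets M = sets borel" by (simp add: M_def)
  have "emeasure M (space M) = 1"
    unfolding M_def using A by (simp add: emeasure_uniform_measure ennreal_divide_self)
  then interpret finite_measure M by (intro finite_measureI) simp
  have "(\<integral>\<^sup>+p. ennreal (dist (fst p) (snd p)) \<partial>(M \<Otimes>\<^sub>M M))
      = (\<integral>\<^sup>+p. \<integral>\<^sup>+q. ennreal (dist p q) \<partial>M \<partial>M)"
    by (subst nn_integral_fst[symmetric]) simp_all
  also have "\<dots> = (\<integral>\<^sup>+p. (\<integral>\<^sup>+q. ennreal (dist p q) * indicator S q \<partial>lborel) / ennreal A \<partial>M)"
    unfolding M_def by (simp add: nn_integral_uniform_measure A)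
  also have "\<dots> = (\<integral>\<^sup>+p. (\<integral>\<^sup>+q. ennreal (dist p q) * indicator S q \<partial>lborel) / ennreal A * indicator S p \<partial>lborel) / ennreal A"
    unfolding M_def by (subst nn_integral_uniform_measure) (simp_all add: A)
  also have "(\<integral>\<^sup>+p. (\<integral>\<^sup>+q. ennreal (dist p q) * indicator S q \<partial>lborel) / ennreal A * indicator S p \<partial>lborel)
     = (\<integral>\<^sup>+p. (\<integral>\<^sup>+q. indicator S p * indicator S q * ennreal (norm (q - p)) \<partial>lborel) / ennreal A \<partial>lborel)"
  proof (intro nn_integral_cong)
    fix p :: "real \<times> real"
    show "(\<integral>\<^sup>+q. ennreal (dist p q) * indicator S q \<partial>lborel) / ennreal A * indicator S p
      = (\<integral>\<^sup>+q. indicator S p * indicator S q * ennreal (norm (q - p)) \<partial>lborel) / ennreal A"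
      by (cases "p \<in> S") (simp_all add: dist_norm norm_minus_commute mult.commute)
  qed
  also have "\<dots> = pair_energy (\<lambda>v. ennreal (norm v)) S / ennreal A"
    unfolding pair_energy_def by (subst nn_integral_divide) simp_all
  also have "\<dots> / ennreal A = ennreal (I / A\<^sup>2)"
    using A I by (simp add: divide_ennreal power2_eq_square)
  finally have "(\<integral>\<^sup>+p. ennreal (dist (fst p) (snd p)) \<partial>(M \<Otimes>\<^sub>M M)) = ennreal (I / A\<^sup>2)" .
  moreover have "mean_distance S = enn2real (\<integral>\<^sup>+p. ennreal (dist (fst p) (snd p)) \<partial>(M \<Otimes>\<^sub>M M))"
    unfolding mean_distance_def M_def[symmetric]
    by (rule integral_eq_nn_integral) simp_all
  ultimately show ?thesis using I by simp
qed

section \<open>Pairs of points parametrised by their connecting line\<close>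

definition chord_energy :: "real set \<Rightarrow> ennreal" where
  "chord_energy C = (\<integral>\<^sup>+x. \<integral>\<^sup>+x'. indicator C x * indicator C x' * ennreal ((x' - x)\<^sup>2) \<partial>lborel \<partial>lborel)"

lemma nn_integral_swap:
  fixes f :: "real \<Rightarrow> real \<Rightarrow> ennreal"
  assumes "case_prod f \<in> borel_measurable (borel \<Otimes>\<^sub>M borel)"
  shows "(\<integral>\<^sup>+y. \<integral>\<^sup>+x. f x y \<partial>lborel \<partial>lborel) = (\<integral>\<^sup>+x. \<integral>\<^sup>+y. f x y \<partial>lborel \<partial>lborel)"
  by (rule lborel_pair.Fubini') (use assms in simp)

text \<open>The change of variables \<open>y = m x + b\<close>, \<open>y' = m x' + b\<close> has Jacobian \<open>\<bar>x' - x\<bar>\<close>.\<close>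

lemma pair_energy_lines:
  fixes S :: "(real \<times> real) set" and t :: real
  assumes S [measurable]: "S \<in> sets borel"
  shows "pair_energy (\<lambda>v. indicator {v. \<bar>snd v\<bar> < t * \<bar>fst v\<bar>} v * ennreal (norm v)) S =
    (\<integral>\<^sup>+m. indicator {-t<..<t} m * ennreal (sqrt (1 + m\<^sup>2)) *
       (\<integral>\<^sup>+b. chord_energy {x. (x, b + m * x) \<in> S} \<partial>lborel) \<partial>lborel)"
proof -
  have S' [measurable]: "S \<in> sets (borel \<Otimes>\<^sub>M borel)"
    unfolding borel_prod by (rule S)
  define W :: "real \<Rightarrow> real \<Rightarrow> ennreal" where
    "W x y = indicator {v. \<bar>snd v\<bar> < t * \<bar>fst v\<bar>} (x, y) * ennreal (norm (x, y))" for x y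
  have W: "W x y = (if \<bar>y\<bar> < t * \<bar>x\<bar> then ennreal (sqrt (x\<^sup>2 + y\<^sup>2)) else 0)" for x y
    by (simp add: W_def norm_prod_def)
  have [measurable]: "case_prod W \<in> borel_measurable (borel \<Otimes>\<^sub>M borel)"
    unfolding W by measurable
  have [measurable]: "(\<lambda>v. indicator {v. \<bar>snd v\<bar> < t * \<bar>fst v\<bar>} v * ennreal (norm v)) \<in> borel_measurable (borel :: (real \<times> real) measure)"
    unfolding borel_prod[symmetric] norm_prod_def by measurable
  \<comment> \<open>\<open>H\<close> is the integrand after y' = y + (x' - x) m; \<open>K\<close> is
    \<open>H\<close> after y = b + m x as well, which makes it symmetric in the two
    abscissae.\<close>
  define H :: "real \<Rightarrow> real \<Rightarrow> real \<Rightarrow> real \<Rightarrow> ennreal" where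
    "H x y x' m = indicator S (x, y) * indicator S (x', y + (x' - x) * m) *
       (indicator {-t<..<t} m * ennreal (sqrt (1 + m\<^sup>2) * (x' - x)\<^sup>2))" for x y x' m
  define K :: "real \<Rightarrow> real \<Rightarrow> real \<Rightarrow> real \<Rightarrow> ennreal" where
    "K m b x x' = indicator S (x, b + m * x) * indicator S (x', b + m * x') *
       (indicator {-t<..<t} m * ennreal (sqrt (1 + m\<^sup>2) * (x' - x)\<^sup>2))" for m b x x'
  \<comment> \<open>Stated for arbitrary arguments, so that every exchange of integrals below is
    discharged with \<open>H\<close> and \<open>K\<close> folded.\<close>
  have [measurable (raw)]: "(\<lambda>z. H (f1 z) (f2 z) (f3 z) (f4 z)) \<in> borel_measurable M"
    if [measurable]: "f1 \<in> borel_measurable M" "f2 \<in> borel_measurable M"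
      "f3 \<in> borel_measurable M" "f4 \<in> borel_measurable M"
    for M :: "'z measure" and f1 f2 f3 f4
    unfolding H_def by measurable
  have [measurable (raw)]: "(\<lambda>z. K (f1 z) (f2 z) (f3 z) (f4 z)) \<in> borel_measurable M"
    if [measurable]: "f1 \<in> borel_measurable M" "f2 \<in> borel_measurable M"
      "f3 \<in> borel_measurable M" "f4 \<in> borel_measurable M"
    for M :: "'z measure" and f1 f2 f3 f4
    unfolding K_def by measurable
  \<comment> \<open>For x' = x the substitution degenerates, but both sides vanish: the left because
    the strict inequality defining the sector fails, the right because of the factor (x' -
    x)^2.\<close>
  have inner: "(\<integral>\<^sup>+y'. indicator S (x, y) * indicator S (x', y') * W (x' - x) (y' - y) \<partial>lborel)
      = (\<integral>\<^sup>+m. H x y x' m \<partial>lborel)" for x y x'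
  proof (cases "x' = x")
    case True
    then show ?thesis by (simp add: W H_def)
  next
    case False
    have "\<bar>x' - x\<bar> * W (x' - x) ((x' - x) * m) = indicator {-t<..<t} m * ennreal (sqrt (1 + m\<^sup>2) * (x' - x)\<^sup>2)" for m
    proof -
      define d where "d = x' - x"
      have d: "\<bar>d\<bar> > 0" using False by (simp add: d_def)
      have "\<bar>d * m\<bar> < t * \<bar>d\<bar> \<longleftrightarrow> \<bar>m\<bar> < t"
        unfolding abs_mult mult.commute[of t] by (rule mult_less_cancel_left_pos[OF d])
      then have 1: "\<bar>d * m\<bar> < t * \<bar>d\<bar> \<longleftrightarrow> m \<in> {-t<..<t}"
        by auto
      have "d\<^sup>2 + (d * m)\<^sup>2 = d\<^sup>2 * (1 + m\<^sup>2)"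
        by (simp add: power_mult_distrib distrib_left)
      then have 2: "\<bar>d\<bar> * sqrt (d\<^sup>2 + (d * m)\<^sup>2) = sqrt (1 + m\<^sup>2) * d\<^sup>2"
        by (simp only: real_sqrt_mult real_sqrt_abs) (simp add: power2_eq_square[of d])
      show ?thesis
        unfolding d_def[symmetric] W 1 by (simp add: 2 flip: ennreal_mult')
    qed
    moreover have "e * (i * j * w) = i * j * (e * w)" for e i j w :: ennreal
      by (simp add: mult_ac)
    ultimately have *: "\<bar>x' - x\<bar> * (indicator S (x, y) * indicator S (x', y + (x' - x) * m) * W (x' - x) (y + (x' - x) * m - y))
      = H x y x' m" for m
      by (simp only: H_def add_diff_cancel_left')
    have "(\<integral>\<^sup>+y'. indicator S (x, y) * indicator S (x', y') * W (x' - x) (y' - y) \<partial>lborel) =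
      \<bar>x' - x\<bar> * (\<integral>\<^sup>+m. indicator S (x, y) * indicator S (x', y + (x' - x) * m) * W (x' - x) (y + (x' - x) * m - y) \<partial>lborel)"
      by (rule nn_integral_real_affine, measurable) (use False in simp)
    also have "\<dots> = (\<integral>\<^sup>+m. \<bar>x' - x\<bar> * (indicator S (x, y) * indicator S (x', y + (x' - x) * m) * W (x' - x) (y + (x' - x) * m - y)) \<partial>lborel)"
      by (rule nn_integral_cmult[symmetric]) measurable
    finally show ?thesis by (simp only: *)
  qed
  have "pair_energy (\<lambda>v. indicator {v. \<bar>snd v\<bar> < t * \<bar>fst v\<bar>} v * ennreal (norm v)) S
    = (\<integral>\<^sup>+x. \<integral>\<^sup>+y. \<integral>\<^sup>+x'. \<integral>\<^sup>+y'. indicator S (x, y) * indicator S (x', y') * W (x' - x) (y' - y) \<partial>lborel \<partial>lborel \<partial>lborel \<partial>lborel)"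
    unfolding pair_energy_def W_def
    by (simp add: nn_integral_lborel_pair(1))
  also have "\<dots> = (\<integral>\<^sup>+x. \<integral>\<^sup>+y. \<integral>\<^sup>+x'. \<integral>\<^sup>+m. H x y x' m \<partial>lborel \<partial>lborel \<partial>lborel \<partial>lborel)"
    by (simp only: inner)
  \<comment> \<open>Three exchanges carry the slope from the innermost to the outermost
    integral.\<close>
  also have "\<dots> = (\<integral>\<^sup>+x. \<integral>\<^sup>+y. \<integral>\<^sup>+m. \<integral>\<^sup>+x'. H x y x' m \<partial>lborel \<partial>lborel \<partial>lborel \<partial>lborel)"
    by (intro nn_integral_cong nn_integral_swap) measurable
  also have "\<dots> = (\<integral>\<^sup>+x. \<integral>\<^sup>+m. \<integral>\<^sup>+y. \<integral>\<^sup>+x'. H x y x' m \<partial>lborel \<partial>lborel \<partial>lborel \<partial>lborel)"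
    by (intro nn_integral_cong nn_integral_swap) measurable
  also have "\<dots> = (\<integral>\<^sup>+m. \<integral>\<^sup>+x. \<integral>\<^sup>+y. \<integral>\<^sup>+x'. H x y x' m \<partial>lborel \<partial>lborel \<partial>lborel \<partial>lborel)"
    by (intro nn_integral_swap) measurable
  also have "\<dots> = (\<integral>\<^sup>+m. \<integral>\<^sup>+x. \<integral>\<^sup>+b. \<integral>\<^sup>+x'. K m b x x' \<partial>lborel \<partial>lborel \<partial>lborel \<partial>lborel)"
  proof (rule nn_integral_cong, rule nn_integral_cong)
    \<comment> \<open>With slope and abscissa fixed, passing from y to the intercept is a
      translation, so no further Jacobian appears.\<close>
    fix m x :: real
    have "(\<integral>\<^sup>+y. \<integral>\<^sup>+x'. H x y x' m \<partial>lborel \<partial>lborel)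
      = ennreal \<bar>1\<bar> * (\<integral>\<^sup>+b. \<integral>\<^sup>+x'. H x (m * x + 1 * b) x' m \<partial>lborel \<partial>lborel)"
      by (rule nn_integral_real_affine) simp_all
    also have "(\<lambda>b x'. H x (m * x + 1 * b) x' m) = (\<lambda>b x'. K m b x x')"
      by (simp add: H_def K_def algebra_simps)
    finally show "(\<integral>\<^sup>+y. \<integral>\<^sup>+x'. H x y x' m \<partial>lborel \<partial>lborel) = (\<integral>\<^sup>+b. \<integral>\<^sup>+x'. K m b x x' \<partial>lborel \<partial>lborel)"
      by simp
  qed
  also have "\<dots> = (\<integral>\<^sup>+m. \<integral>\<^sup>+b. \<integral>\<^sup>+x. \<integral>\<^sup>+x'. K m b x x' \<partial>lborel \<partial>lborel \<partial>lborel \<partial>lborel)"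
    by (intro nn_integral_cong nn_integral_swap) measurable
  also have "\<dots> = (\<integral>\<^sup>+m. indicator {-t<..<t} m * ennreal (sqrt (1 + m\<^sup>2)) *
       (\<integral>\<^sup>+b. chord_energy {x. (x, b + m * x) \<in> S} \<partial>lborel) \<partial>lborel)"
  proof (intro nn_integral_cong)
    fix m :: real
    define c where "c = indicator {-t<..<t} m * ennreal (sqrt (1 + m\<^sup>2))"
    have "K m b x x' = c * (indicator {x. (x, b + m * x) \<in> S} x * indicator {x. (x, b + m * x) \<in> S} x' * ennreal ((x' - x)\<^sup>2))" for b x x'
      by (simp add: K_def c_def indicator_def ennreal_mult')
    then show "(\<integral>\<^sup>+b. \<integral>\<^sup>+x. \<integral>\<^sup>+x'. K m b x x' \<partial>lborel \<partial>lborel \<partial>lborel)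
      = c * (\<integral>\<^sup>+b. chord_energy {x. (x, b + m * x) \<in> S} \<partial>lborel)"
      unfolding chord_energy_def by (simp add: nn_integral_cmult)
  qed
  finally show ?thesis .
qed

section \<open>Energy of an interval of abscissae\<close>

lemma nn_integral_Icc:
  fixes f F :: "real \<Rightarrow> real"
  assumes "f \<in> borel_measurable borel"
    and "\<And>x. a \<le> x \<Longrightarrow> x \<le> b \<Longrightarrow> (F has_real_derivative f x) (at x)"
    and "\<And>x. a \<le> x \<Longrightarrow> x \<le> b \<Longrightarrow> 0 \<le> f x" and "a \<le> b"
  shows "(\<integral>\<^sup>+x. indicator {a..b} x * ennreal (f x) \<partial>lborel) = ennreal (F b - F a)"
  using nn_integral_FTC_Icc[of f a b F] assms by (simp add: mult.commute)

text \<open>Two polynomial integrations; each end of the interval contributes (u - l)^4 /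
  12.\<close>

lemma chord_energy_Icc:
  assumes "l \<le> u"
  shows "chord_energy {l..u} = ennreal ((u - l) ^ 4 / 6)"
proof -
  have e: "(l - u) ^ 4 = (u - l) ^ 4"
    by (simp add: power4_eq_xxxx algebra_simps)
  have inner: "(\<integral>\<^sup>+x'. indicator {l..u} x' * ennreal ((x' - x)\<^sup>2) \<partial>lborel) = ennreal (((u - x) ^ 3 - (l - x) ^ 3) / 3)" for x
    by (subst nn_integral_Icc[where F = "\<lambda>y. (y - x) ^ 3 / 3"])
       (auto intro!: derivative_eq_intros assms simp: diff_divide_distrib)
  have "chord_energy {l..u} = (\<integral>\<^sup>+x. indicator {l..u} x * ennreal (((u - x) ^ 3 - (l - x) ^ 3) / 3) \<partial>lborel)"
    unfolding chord_energy_def by (simp add: mult.assoc nn_integral_cmult inner)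
  also have "\<dots> = ennreal (((l - u) ^ 4 - (u - u) ^ 4) / 12 - ((l - l) ^ 4 - (u - l) ^ 4) / 12)"
  proof (rule nn_integral_Icc)
    fix x assume "l \<le> x" "x \<le> u"
    then show "0 \<le> ((u - x) ^ 3 - (l - x) ^ 3) / 3"
      using power_mono_odd[of 3 "l - x" "u - x"] by simp
    show "((\<lambda>x. ((l - x) ^ 4 - (u - x) ^ 4) / 12) has_real_derivative ((u - x) ^ 3 - (l - x) ^ 3) / 3) (at x)"
      by (auto intro!: derivative_eq_intros)
  qed (use assms in auto)
  also have "\<dots> = ennreal ((u - l) ^ 4 / 6)"
    by (simp add: e)
  finally show ?thesis .
qed

text \<open>Reflecting both abscissae keeps their squared difference. This is what allows
  restricting slope and intercept to nonnegative values.\<close>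

lemma chord_energy_uminus:
  assumes C [measurable]: "C \<in> sets borel"
  shows "chord_energy {x. - x \<in> C} = chord_energy C"
proof -
  have *: "(\<integral>\<^sup>+x'. indicator C x * indicator C x' * ennreal ((x' - x)\<^sup>2) \<partial>lborel)
      = (\<integral>\<^sup>+x'. indicator C x * indicator C (- x') * ennreal ((x' - - x)\<^sup>2) \<partial>lborel)" for x
    using nn_integral_real_affine[of "\<lambda>x'. indicator C x * indicator C x' * ennreal ((x' - x)\<^sup>2)" "-1" 0]
    by (simp add: power2_commute add.commute)
  have "chord_energy C = (\<integral>\<^sup>+x. \<integral>\<^sup>+x'. indicator C (- x) * indicator C x' * ennreal ((x' - - x)\<^sup>2) \<partial>lborel \<partial>lborel)"
    unfolding chord_energy_def
    using nn_integral_real_affine[of "\<lambda>x. \<integral>\<^sup>+x'. indicator C x * indicator C x' * ennreal ((x' - x)\<^sup>2) \<partial>lborel" "-1" 0]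
    by simp
  also have "\<dots> = (\<integral>\<^sup>+x. \<integral>\<^sup>+x'. indicator C (- x) * indicator C (- x') * ennreal ((x' - x)\<^sup>2) \<partial>lborel \<partial>lborel)"
  proof (rule nn_integral_cong)
    fix x :: real
    show "(\<integral>\<^sup>+x'. indicator C (- x) * indicator C x' * ennreal ((x' - - x)\<^sup>2) \<partial>lborel) =
      (\<integral>\<^sup>+x'. indicator C (- x) * indicator C (- x') * ennreal ((x' - x)\<^sup>2) \<partial>lborel)"
      using *[of "- x"] by simp
  qed
  finally show ?thesis
    by (simp add: chord_energy_def indicator_def)
qed

section \<open>Chords of the octagon\<close>

text \<open>\<open>\<tau> = tan (\<pi> / 8)\<close> is half the side of the octagon with apothem 1.\<close>

definition \<tau> :: real where "\<tau> = sqrt 2 - 1"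

text \<open>The doubling formula for the tangent at pi/8, where tan(pi/4) = 1.\<close>

lemma tau_square: "\<tau>\<^sup>2 = 1 - 2 * \<tau>"
  by (simp add: \<tau>_def power2_eq_square algebra_simps)

lemma tau_bounds: "0 < \<tau>" "\<tau> < 1 / 2"
proof -
  show "0 < \<tau>" by (simp add: \<tau>_def)
  have "sqrt 2 < sqrt ((3 / 2)\<^sup>2)" by (rule real_sqrt_less_mono) (simp add: power2_eq_square)
  then show "\<tau> < 1 / 2" by (simp add: \<tau>_def)
qed

text \<open>Since 1 + \<open>\<tau>\<close> = sqrt 2, the slanted sides also have distance 1 from
  the origin. Chords are read off from these inequalities; the agreement with the hull of the
  vertices is a separate lemma.\<close>

definition octagon :: "(real \<times> real) set" where
  "octagon = {p. \<bar>fst p\<bar> \<le> 1 \<and> \<bar>snd p\<bar> \<le> 1 \<and> \<bar>fst p\<bar> + \<bar>snd p\<bar> \<le> 1 + \<tau>}"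

lemma mem_octagon: "(x, y) \<in> octagon \<longleftrightarrow> \<bar>x\<bar> \<le> 1 \<and> \<bar>y\<bar> \<le> 1 \<and> \<bar>x\<bar> + \<bar>y\<bar> \<le> 1 + \<tau>"
  by (simp add: octagon_def)

lemma octagon_measurable [measurable]: "octagon \<in> sets borel"
proof -
  have "closed octagon"
    unfolding octagon_def by (intro closed_Collect_conj closed_Collect_le continuous_intros)
  then show ?thesis by (rule borel_closed)
qed

lemma convex_octagon: "convex octagon"
proof -
  have "octagon = {p. (1, 0) \<bullet> p \<le> 1} \<inter> {p. (-1, 0) \<bullet> p \<le> 1} \<inter> {p. (0, 1) \<bullet> p \<le> 1} \<inter> {p. (0, -1) \<bullet> p \<le> 1}
      \<inter> {p. (1, 1) \<bullet> p \<le> 1 + \<tau>} \<inter> {p. (1, -1) \<bullet> p \<le> 1 + \<tau>} \<inter> {p. (-1, 1) \<bullet> p \<le> 1 + \<tau>} \<inter> {p. (-1, -1) \<bullet> p \<le> 1 + \<tau>}"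
    by (auto simp: mem_octagon)
  then show ?thesis
    by (rule ssubst) (intro convex_Int convex_halfspace_le)
qed

definition octagon_chord :: "real \<Rightarrow> real \<Rightarrow> real set" where
  "octagon_chord m b = {x. (x, b + m * x) \<in> octagon}"

text \<open>Convexity fills the segment between two points of the octagon, so a chord is determined
  by two members and matching bounds.\<close>

lemma octagon_chord_Icc:
  assumes l: "(l, b + m * l) \<in> octagon" and u: "(u, b + m * u) \<in> octagon"
    and bounds: "\<And>x. (x, b + m * x) \<in> octagon \<Longrightarrow> l \<le> x \<and> x \<le> u"
  shows "octagon_chord m b = {l..u}"
proof -
  have "(x, b + m * x) \<in> octagon" if x: "x \<in> {l..u}" for x
  proof (cases "l = u")
    case True
    then show ?thesis using x l by simp
  next
    case False
    define k where "k = (x - l) / (u - l)"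
    have k: "0 \<le> k" "k \<le> 1" and "k * (u - l) = x - l"
      using x False by (auto simp: k_def)
    then have x': "x = (1 - k) * l + k * u" by (simp add: algebra_simps)
    have "b + m * x = (1 - k) * (b + m * l) + k * (b + m * u)"
      unfolding x' by (simp add: algebra_simps)
    with x' have "(x, b + m * x) = (1 - k) *\<^sub>R (l, b + m * l) + k *\<^sub>R (u, b + m * u)"
      by simp
    then show ?thesis
      using convexD_alt[OF convex_octagon l u k] by (simp only:)
  qed
  then show ?thesis
    unfolding octagon_chord_def using bounds by (intro set_eqI) (metis atLeastAtMost_iff mem_Collect_eq)
qed

section \<open>Ends of the chords for slopes between 0 and \<open>\<tau>\<close>\<close>

context
  fixes m b :: real
  assumes m: "0 \<le> m" "m \<le> \<tau>"
begin

text \<open>Here and in the next four lemmas the thresholds for \<open>b\<close> mark the passage of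
  the line through a vertex: \<tau> - m for (1, \<tau>), \<tau> + m for (-1, \<tau>), 1 - \<tau> m
  for (\<tau>, 1), and 1 + \<tau> m for (-\<tau>, 1).\<close>

lemma octagon_right:
  assumes "0 \<le> b" "b \<le> \<tau> - m"
  shows "(1, b + m) \<in> octagon"
  using assms m tau_bounds by (simp add: mem_octagon)

lemma octagon_left:
  assumes "0 \<le> b" "b \<le> \<tau> + m"
  shows "(-1, b - m) \<in> octagon"
  using assms m tau_bounds by (auto simp: mem_octagon abs_le_iff)

lemma octagon_upper_right:
  assumes "\<tau> - m \<le> b" "b \<le> 1 - \<tau> * m"
  defines "x \<equiv> (1 + \<tau> - b) / (1 + m)"
  shows "(x, b + m * x) \<in> octagon"
proof -
  have "b + m * x = 1 + \<tau> - x" "\<tau> \<le> x" "x \<le> 1"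
    using m assms by (simp_all add: x_def field_simps)
  then show ?thesis
    using tau_bounds by (simp add: mem_octagon)
qed

lemma octagon_upper_left:
  assumes "\<tau> + m \<le> b" "b \<le> 1 + \<tau> * m"
  defines "x \<equiv> - ((1 + \<tau> - b) / (1 - m))"
  shows "(x, b + m * x) \<in> octagon"
proof -
  have "b + m * x = 1 + \<tau> + x" "x \<le> - \<tau>" "-1 \<le> x"
    using m tau_bounds assms by (simp_all add: x_def field_simps)
  then show ?thesis
    using tau_bounds by (simp add: mem_octagon)
qed

lemma octagon_top:
  assumes "m > 0" "1 - \<tau> * m \<le> b" "b \<le> 1 + \<tau> * m"
  shows "((1 - b) / m, b + m * ((1 - b) / m)) \<in> octagon"
proof -
  define x where "x = (1 - b) / m"
  have "- \<tau> \<le> x" "x \<le> \<tau>" "b + m * x = 1"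
    using assms by (simp_all add: x_def field_simps)
  then show ?thesis
    unfolding x_def[symmetric] using tau_bounds by (auto simp: mem_octagon abs_le_iff)
qed

text \<open>Each bound on \<open>x\<close> solves the inequality of one side; together they match
  the candidate end points above.\<close>

lemma octagon_chord_bounds:
  assumes "(x, b + m * x) \<in> octagon"
  shows "-1 \<le> x" "x \<le> 1" "x \<le> (1 + \<tau> - b) / (1 + m)" "- ((1 + \<tau> - b) / (1 - m)) \<le> x"
    "m > 0 \<Longrightarrow> x \<le> (1 - b) / m" "b \<le> 1 + \<tau> * m"
proof -
  have *: "-1 \<le> x" "x \<le> 1" "x + (b + m * x) \<le> 1 + \<tau>" "- x + (b + m * x) \<le> 1 + \<tau>" "b + m * x \<le> 1"
    using assms by (auto simp: mem_octagon)
  then show "-1 \<le> x" "x \<le> 1" by auto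
  show "x \<le> (1 + \<tau> - b) / (1 + m)" "- ((1 + \<tau> - b) / (1 - m)) \<le> x" "m > 0 \<Longrightarrow> x \<le> (1 - b) / m"
    using * m tau_bounds by (simp_all add: field_simps)
  \<comment> \<open>The vertex (-\<tau>, 1) is the last one the rising line meets: to its right the
    top side limits \<open>b\<close>, to its left the upper left side.\<close>
  show "b \<le> 1 + \<tau> * m"
  proof (cases "- \<tau> \<le> x")
    case True
    then have "m * (- \<tau>) \<le> m * x" using m by (intro mult_left_mono)
    then show ?thesis using * by (simp add: mult.commute)
  next
    case False
    then have "(1 - m) * x \<le> (1 - m) * (- \<tau>)" using m tau_bounds by (intro mult_left_mono) auto
    then show ?thesis using * by (simp add: algebra_simps)
  qed
qed

lemma octagon_chord_left_right:
  assumes "0 \<le> b" "b \<le> \<tau> - m"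
  shows "octagon_chord m b = {-1..1}"
  by (rule octagon_chord_Icc) (use assms m octagon_left octagon_right octagon_chord_bounds in auto)

lemma octagon_chord_left_upper_right:
  assumes "\<tau> - m \<le> b" "b \<le> \<tau> + m"
  shows "octagon_chord m b = {-1..(1 + \<tau> - b) / (1 + m)}"
proof (rule octagon_chord_Icc)
  \<comment> \<open>As \<tau> (1 + \<tau>) = 1 - \<tau>, this orders two thresholds, \<tau> + m
    \<le> 1 - \<tau> m, with equality at m = \<tau>.\<close>
  have "m * (1 + \<tau>) \<le> \<tau> * (1 + \<tau>)" using m tau_bounds by (intro mult_right_mono) auto
  then have "b \<le> 1 - \<tau> * m" using assms tau_square by (simp add: algebra_simps power2_eq_square)
  then show "((1 + \<tau> - b) / (1 + m), b + m * ((1 + \<tau> - b) / (1 + m))) \<in> octagon"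
    using assms octagon_upper_right by simp
qed (use assms m octagon_left octagon_chord_bounds in auto)

lemma octagon_chord_upper_left_upper_right:
  assumes "\<tau> + m \<le> b" "b \<le> 1 - \<tau> * m"
  shows "octagon_chord m b = {- ((1 + \<tau> - b) / (1 - m))..(1 + \<tau> - b) / (1 + m)}"
proof (rule octagon_chord_Icc)
  have "0 \<le> \<tau> * m" using m tau_bounds by simp
  then have "b \<le> 1 + \<tau> * m" using assms by linarith
  then show "(- ((1 + \<tau> - b) / (1 - m)), b + m * - ((1 + \<tau> - b) / (1 - m))) \<in> octagon"
    using assms octagon_upper_left by simp
  show "((1 + \<tau> - b) / (1 + m), b + m * ((1 + \<tau> - b) / (1 + m))) \<in> octagon"
    using assms m octagon_upper_right by simp
qed (use octagon_chord_bounds in auto)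

lemma octagon_chord_upper_left_top:
  assumes "0 < m" "1 - \<tau> * m \<le> b" "b \<le> 1 + \<tau> * m"
  shows "octagon_chord m b = {- ((1 + \<tau> - b) / (1 - m))..(1 - b) / m}"
proof (rule octagon_chord_Icc)
  have "m * (1 + \<tau>) \<le> \<tau> * (1 + \<tau>)" using m tau_bounds by (intro mult_right_mono) auto
  then have "\<tau> + m \<le> b" using assms tau_square by (simp add: algebra_simps power2_eq_square)
  then show "(- ((1 + \<tau> - b) / (1 - m)), b + m * - ((1 + \<tau> - b) / (1 - m))) \<in> octagon"
    using assms octagon_upper_left by simp
  show "((1 - b) / m, b + m * ((1 - b) / m)) \<in> octagon"
    using assms by (rule octagon_top)
qed (use assms octagon_chord_bounds in auto)

lemma octagon_chord_empty: "1 + \<tau> * m < b \<Longrightarrow> octagon_chord m b = {}"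
  using octagon_chord_bounds(6) by (force simp: octagon_chord_def)

end

lemma octagon_chord_measurable [measurable]: "octagon_chord m b \<in> sets borel"
proof -
  have "octagon \<in> sets (borel \<Otimes>\<^sub>M borel)" unfolding borel_prod by (rule octagon_measurable)
  then show ?thesis unfolding octagon_chord_def by measurable
qed

text \<open>Changing the sign of the slope is the reflection in the vertical axis; changing that of
  the intercept is the reflection in the centre.\<close>

lemma octagon_chord_uminus:
  "octagon_chord (- m) b = {x. - x \<in> octagon_chord m b}"
  "octagon_chord m (- b) = {x. - x \<in> octagon_chord m b}"
proof -
  have "\<bar>- b + m * x\<bar> = \<bar>b - m * x\<bar>" for x by simp
  then show "octagon_chord m (- b) = {x. - x \<in> octagon_chord m b}"
    by (auto simp: octagon_chord_def mem_octagon)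
qed (auto simp: octagon_chord_def mem_octagon)

section \<open>Integration over the intercept\<close>

lemma nn_integral_even:
  fixes f :: "real \<Rightarrow> ennreal"
  assumes [measurable]: "f \<in> borel_measurable borel" and even: "\<And>x. f (- x) = f x"
  shows "(\<integral>\<^sup>+x. f x \<partial>lborel) = 2 * (\<integral>\<^sup>+x. indicator {0..} x * f x \<partial>lborel)"
proof -
  have "(\<integral>\<^sup>+x. f x \<partial>lborel) = (\<integral>\<^sup>+x. indicator {0..} x * f x + indicator {..0} x * f x \<partial>lborel)"
    \<comment> \<open>The two closed half-lines overlap in the null set {0}.\<close>
    by (intro nn_integral_cong_AE eventually_mono[OF AE_lborel_singleton[of 0]])
       (auto simp: indicator_def)
  also have "\<dots> = (\<integral>\<^sup>+x. indicator {0..} x * f x \<partial>lborel) + (\<integral>\<^sup>+x. indicator {..0} x * f x \<partial>lborel)"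
    by (rule nn_integral_add) measurable
  also have "(\<integral>\<^sup>+x. indicator {..0} x * f x \<partial>lborel) = (\<integral>\<^sup>+x. indicator {0..} x * f x \<partial>lborel)"
    using nn_integral_real_affine[of "\<lambda>x. indicator {..0} x * f x" "-1" 0]
    by (simp add: even indicator_def)
  finally show ?thesis by (simp add: mult_2)
qed

lemma octagon_chord_energy_measurable [measurable]:
  "(\<lambda>(m, b). chord_energy (octagon_chord m b)) \<in> borel_measurable (borel \<Otimes>\<^sub>M borel)"
proof -
  have [measurable]: "octagon \<in> sets (borel \<Otimes>\<^sub>M borel)"
    unfolding borel_prod by (rule octagon_measurable)
  have "indicator (octagon_chord m b) x = (indicator octagon (x, b + m * x) :: ennreal)" for m b x
    by (simp add: octagon_chord_def indicator_def)
  then show ?thesis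
    unfolding chord_energy_def by simp
qed

lemma octagon_chord_energy_measurable_intercept [measurable]:
  "(\<lambda>b. chord_energy (octagon_chord m b)) \<in> borel_measurable borel"
  using measurable_compose[OF _ octagon_chord_energy_measurable, of "\<lambda>b. (m, b)" borel] by simp

text \<open>Horizontal slices are the chords with m = 0, of length 2 up to height \<tau> and 2 (1 +
  \<tau> - b) above it. The value is half the perimeter 16 \<tau> times the apothem 1.\<close>

lemma emeasure_octagon: "emeasure lborel octagon = ennreal (8 * \<tau>)"
proof -
  have oct [measurable]: "octagon \<in> sets (borel \<Otimes>\<^sub>M borel)"
    unfolding borel_prod by (rule octagon_measurable)
  let ?E = "\<lambda>b. emeasure lborel (octagon_chord 0 b)"
  have E: "?E b = (\<integral>\<^sup>+x. indicator octagon (x, b) \<partial>lborel)" for b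
  proof -
    have "indicator octagon (x, b) = (indicator (octagon_chord 0 b) x :: ennreal)" for x
      by (simp add: octagon_chord_def indicator_def)
    then show ?thesis by simp
  qed
  have [measurable]: "?E \<in> borel_measurable borel"
    unfolding E by measurable
  have "emeasure lborel octagon = (\<integral>\<^sup>+p. indicator octagon p \<partial>lborel)"
    by simp
  also have "\<dots> = (\<integral>\<^sup>+b. ?E b \<partial>lborel)"
    unfolding E by (rule nn_integral_lborel_pair(2)) measurable
  also have "\<dots> = 2 * (\<integral>\<^sup>+b. indicator {0..} b * ?E b \<partial>lborel)"
  proof (rule nn_integral_even)
    have "octagon_chord 0 (- b) = octagon_chord 0 b" for b
      by (simp add: octagon_chord_def mem_octagon)
    then show "?E (- b) = ?E b" for b by simp
  qed measurable
  also have "(\<integral>\<^sup>+b. indicator {0..} b * ?E b \<partial>lborel) =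
    (\<integral>\<^sup>+b. indicator {0..\<tau>} b * ennreal 2 + indicator {\<tau>..1} b * ennreal (2 * (1 + \<tau> - b)) \<partial>lborel)"
  proof (intro nn_integral_cong_AE eventually_mono[OF AE_lborel_singleton[of \<tau>]])
    fix b :: real assume "b \<noteq> \<tau>"
    then consider "b < 0" | "0 \<le> b" "b < \<tau>" | "\<tau> < b" "b \<le> 1" | "1 < b" by linarith
    then show "indicator {0..} b * ?E b =
      indicator {0..\<tau>} b * ennreal 2 + indicator {\<tau>..1} b * ennreal (2 * (1 + \<tau> - b))"
    proof cases
      case 1 then show ?thesis using tau_bounds by simp
    next
      case 2 then show ?thesis using tau_bounds octagon_chord_left_right[of 0 b] by simp
    next
      case 3 then show ?thesis using tau_bounds octagon_chord_upper_left_upper_right[of 0 b] by simp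
    next
      case 4 then show ?thesis using tau_bounds octagon_chord_empty[of 0 b] by simp
    qed
  qed
  also have "\<dots> = ennreal (2 * \<tau>) + ennreal (1 - \<tau>\<^sup>2)"
  proof (subst nn_integral_add)
    have "(\<integral>\<^sup>+b. indicator {0..\<tau>} b * ennreal 2 \<partial>lborel) = ennreal (2 * \<tau> - 2 * 0)"
      by (rule nn_integral_Icc) (use tau_bounds in \<open>auto intro!: derivative_eq_intros\<close>)
    moreover have "(\<integral>\<^sup>+b. indicator {\<tau>..1} b * ennreal (2 * (1 + \<tau> - b)) \<partial>lborel)
        = ennreal (- (1 + \<tau> - 1)\<^sup>2 - - (1 + \<tau> - \<tau>)\<^sup>2)"
      by (rule nn_integral_Icc) (use tau_bounds in \<open>auto intro!: derivative_eq_intros\<close>)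
    ultimately show "(\<integral>\<^sup>+b. indicator {0..\<tau>} b * ennreal 2 \<partial>lborel)
        + (\<integral>\<^sup>+b. indicator {\<tau>..1} b * ennreal (2 * (1 + \<tau> - b)) \<partial>lborel) = ennreal (2 * \<tau>) + ennreal (1 - \<tau>\<^sup>2)"
      by simp
  qed measurable
  also have "2 * \<dots> = ennreal (8 * \<tau>)"
    using tau_bounds by (simp add: tau_square flip: ennreal_plus ennreal_numeral ennreal_mult)
  finally show ?thesis .
qed

text \<open>\<open>L\<close> stands for a chord length that is affine in the intercept; writing its
  slope as -1/k keeps the antiderivative polynomial in \<open>k\<close> and
  \<open>L\<close>.\<close>

lemma nn_integral_Icc_linear_power4:
  fixes L :: "real \<Rightarrow> real"
  assumes L: "\<And>b. (L has_real_derivative - 1 / k) (at b)" and k: "k \<noteq> 0" and xy: "x \<le> y"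
  shows "(\<integral>\<^sup>+b. indicator {x..y} b * ennreal (L b ^ 4 / 6) \<partial>lborel) = ennreal (- k / 30 * L y ^ 5 - - k / 30 * L x ^ 5)"
proof (rule nn_integral_Icc)
  have "continuous_on UNIV L"
    using L by (intro DERIV_continuous_on) auto
  then have "L \<in> borel_measurable borel"
    by (rule borel_measurable_continuous_onI)
  then show "(\<lambda>b. L b ^ 4 / 6) \<in> borel_measurable borel" by simp
  show "((\<lambda>b. - k / 30 * L b ^ 5) has_real_derivative L b ^ 4 / 6) (at b)" for b
    using DERIV_cmult[OF DERIV_power[OF L, of 5], of "- k / 30"] k by simp
qed (use xy in auto)

text \<open>For b \<ge> 0 the chord passes four stages separated by the vertices: constant length 2,
  then three stages in which the length falls linearly, down to 0.\<close>

lemma nn_integral_octagon_chord_energy: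
  assumes m: "0 < m" "m < \<tau>"
  shows "(\<integral>\<^sup>+b. chord_energy (octagon_chord m b) \<partial>lborel) =
    ennreal (16 / 15 * (5 * \<tau> + 2 - 3 * m - 1 / (1 + m) ^ 3 - \<tau> ^ 5 / (1 - m) ^ 3))"
proof -
  note m' = less_imp_le[OF m(1)] less_imp_le[OF m(2)]
  let ?b1 = "\<tau> - m" and ?b2 = "\<tau> + m" and ?b3 = "1 - \<tau> * m" and ?b4 = "1 + \<tau> * m"
  have b3: "0 < \<tau> * m" using m tau_bounds by simp
  have "m * (1 + \<tau>) \<le> \<tau> * (1 + \<tau>)" using m tau_bounds by (intro mult_right_mono) auto
  then have b2: "?b2 \<le> ?b3" using tau_square by (simp add: algebra_simps power2_eq_square)
  have m1: "m < 1" using m tau_bounds by simp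
  let ?f1 = "\<lambda>b::real. 16 / 6 :: real"
    and ?f2 = "\<lambda>b. (1 + (1 + \<tau> - b) / (1 + m)) ^ 4 / 6"
    and ?f3 = "\<lambda>b. ((1 + \<tau> - b) / (1 + m) + (1 + \<tau> - b) / (1 - m)) ^ 4 / 6"
    and ?f4 = "\<lambda>b. ((1 - b) / m + (1 + \<tau> - b) / (1 - m)) ^ 4 / 6"
  let ?F2 = "\<lambda>b. - (1 + m) / 30 * (1 + (1 + \<tau> - b) / (1 + m)) ^ 5"
    and ?F3 = "\<lambda>b. - ((1 - m) * (1 + m) / 2) / 30 * ((1 + \<tau> - b) / (1 + m) + (1 + \<tau> - b) / (1 - m)) ^ 5"
    and ?F4 = "\<lambda>b. - (m * (1 - m)) / 30 * ((1 - b) / m + (1 + \<tau> - b) / (1 - m)) ^ 5"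
  have d: "((\<lambda>b. (q - b) / k) has_real_derivative - 1 / k) (at b)" for q k b :: real
    using DERIV_cdivide[OF DERIV_diff[OF DERIV_const DERIV_ident], of q k] by simp
  have d2: "((\<lambda>b. 1 + (1 + \<tau> - b) / (1 + m)) has_real_derivative - 1 / (1 + m)) (at b)" for b
    using DERIV_add[OF DERIV_const[of 1] d] by simp
  \<comment> \<open>The slopes of the two chord ends add up; the negative reciprocals of the sums
    are the factors in \<open>?F3\<close> and \<open>?F4\<close>.\<close>
  have "- 1 / (1 + m) + - 1 / (1 - m) = - 1 / ((1 - m) * (1 + m) / 2)"
    "- 1 / m + - 1 / (1 - m) = - 1 / (m * (1 - m))"
    using m m1 by (simp_all add: divide_simps)
  then have d3: "((\<lambda>b. (1 + \<tau> - b) / (1 + m) + (1 + \<tau> - b) / (1 - m)) has_real_derivative - 1 / ((1 - m) * (1 + m) / 2)) (at b)"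
    and d4: "((\<lambda>b. (1 - b) / m + (1 + \<tau> - b) / (1 - m)) has_real_derivative - 1 / (m * (1 - m))) (at b)" for b
    using DERIV_add[OF d[of "1 + \<tau>" "1 + m" b] d[of "1 + \<tau>" "1 - m" b]]
      DERIV_add[OF d[of 1 m b] d[of "1 + \<tau>" "1 - m" b]] by simp_all
  have "(\<integral>\<^sup>+b. chord_energy (octagon_chord m b) \<partial>lborel)
    = 2 * (\<integral>\<^sup>+b. indicator {0..} b * chord_energy (octagon_chord m b) \<partial>lborel)"
    by (rule nn_integral_even) (simp_all add: octagon_chord_uminus(2) chord_energy_uminus)
  also have "(\<integral>\<^sup>+b. indicator {0..} b * chord_energy (octagon_chord m b) \<partial>lborel) =
    (\<integral>\<^sup>+b. indicator {0..?b1} b * ennreal (?f1 b) + indicator {?b1..?b2} b * ennreal (?f2 b) +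
       indicator {?b2..?b3} b * ennreal (?f3 b) + indicator {?b3..?b4} b * ennreal (?f4 b) \<partial>lborel)"
  proof (rule nn_integral_cong_AE)
    \<comment> \<open>Neighbouring closed pieces share their break points, where the sum would count
      twice.\<close>
    have ae: "AE b in lborel. b \<noteq> ?b1 \<and> b \<noteq> ?b2 \<and> b \<noteq> ?b3"
      by (intro AE_conjI AE_lborel_singleton)
    show "AE b in lborel. indicator {0..} b * chord_energy (octagon_chord m b) =
       indicator {0..?b1} b * ennreal (?f1 b) + indicator {?b1..?b2} b * ennreal (?f2 b) +
       indicator {?b2..?b3} b * ennreal (?f3 b) + indicator {?b3..?b4} b * ennreal (?f4 b)"
    proof (rule eventually_mono[OF ae])
      fix b assume ne: "b \<noteq> ?b1 \<and> b \<noteq> ?b2 \<and> b \<noteq> ?b3"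
      consider "b < 0" | "0 \<le> b" "b < ?b1" | "?b1 < b" "b < ?b2" | "?b2 < b" "b < ?b3"
        | "?b3 < b" "b \<le> ?b4" | "?b4 < b"
        using ne by linarith
      then show "indicator {0..} b * chord_energy (octagon_chord m b) =
       indicator {0..?b1} b * ennreal (?f1 b) + indicator {?b1..?b2} b * ennreal (?f2 b) +
       indicator {?b2..?b3} b * ennreal (?f3 b) + indicator {?b3..?b4} b * ennreal (?f4 b)"
      proof cases
        case 1
        then show ?thesis using m b2 b3 by (simp add: indicator_def)
      next
        case 2
        then have "chord_energy (octagon_chord m b) = ennreal (?f1 b)"
          using m' by (simp add: octagon_chord_left_right chord_energy_Icc)
        with 2 show ?thesis using m b2 b3 by (simp add: indicator_def)
      next
        case 3
        have "0 \<le> (1 + \<tau> - b) / (1 + m)" using 3 m b2 b3 tau_bounds by simp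
        then have "chord_energy (octagon_chord m b) = ennreal (?f2 b)"
          using 3 m' by (simp add: octagon_chord_left_upper_right chord_energy_Icc add.commute)
        with 3 show ?thesis using m b2 b3 by (simp add: indicator_def)
      next
        case 4
        then have b: "b < 1" using b3 by linarith
        have "0 \<le> (1 + \<tau> - b) / (1 + m)" "0 \<le> (1 + \<tau> - b) / (1 - m)"
          using b m1 m tau_bounds by simp_all
        then have "chord_energy (octagon_chord m b) = ennreal (?f3 b)"
          using 4 m' by (simp add: octagon_chord_upper_left_upper_right chord_energy_Icc)
        with 4 show ?thesis using m b2 b3 by (simp add: indicator_def)
      next
        case 5
        have "- ((1 + \<tau> - b) / (1 - m)) \<le> (1 - b) / m"
          using octagon_chord_bounds(4)[OF m' octagon_top[OF m' m(1)]] 5 by simp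
        then have "chord_energy (octagon_chord m b) = ennreal (?f4 b)"
          using 5 m m' by (simp add: octagon_chord_upper_left_top chord_energy_Icc)
        with 5 show ?thesis using m b2 b3 by (simp add: indicator_def)
      next
        case 6
        then have "chord_energy (octagon_chord m b) = 0"
          using m' by (simp add: octagon_chord_empty chord_energy_def)
        moreover have "b > ?b1" "b > ?b2" "b > ?b3" using 6 m b2 b3 by linarith+
        ultimately show ?thesis using 6 by simp
      qed
    qed
  qed
  also have "\<dots> = (\<integral>\<^sup>+b. indicator {0..?b1} b * ennreal (?f1 b) \<partial>lborel)
      + (\<integral>\<^sup>+b. indicator {?b1..?b2} b * ennreal (?f2 b) \<partial>lborel)
      + (\<integral>\<^sup>+b. indicator {?b2..?b3} b * ennreal (?f3 b) \<partial>lborel)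
      + (\<integral>\<^sup>+b. indicator {?b3..?b4} b * ennreal (?f4 b) \<partial>lborel)"
    by (simp add: nn_integral_add)
  also have "(\<integral>\<^sup>+b. indicator {0..?b1} b * ennreal (?f1 b) \<partial>lborel) = ennreal (16 / 6 * ?b1 - 16 / 6 * 0)"
    by (rule nn_integral_Icc) (use m in \<open>auto intro!: derivative_eq_intros\<close>)
  also have "(\<integral>\<^sup>+b. indicator {?b1..?b2} b * ennreal (?f2 b) \<partial>lborel) = ennreal (?F2 ?b2 - ?F2 ?b1)"
    by (rule nn_integral_Icc_linear_power4[OF d2]) (use m m1 b2 b3 in auto)
  also have "(\<integral>\<^sup>+b. indicator {?b2..?b3} b * ennreal (?f3 b) \<partial>lborel) = ennreal (?F3 ?b3 - ?F3 ?b2)"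
    by (rule nn_integral_Icc_linear_power4[OF d3]) (use m m1 b2 b3 in auto)
  also have "(\<integral>\<^sup>+b. indicator {?b3..?b4} b * ennreal (?f4 b) \<partial>lborel) = ennreal (?F4 ?b4 - ?F4 ?b3)"
    by (rule nn_integral_Icc_linear_power4[OF d4]) (use m m1 b2 b3 in auto)
  also have "2 * (ennreal (16 / 6 * ?b1 - 16 / 6 * 0) + ennreal (?F2 ?b2 - ?F2 ?b1)
      + ennreal (?F3 ?b3 - ?F3 ?b2) + ennreal (?F4 ?b4 - ?F4 ?b3)) = ennreal (16 / 15 * (5 * \<tau> + 2 - 3 * m - 1 / (1 + m) ^ 3 - \<tau> ^ 5 / (1 - m) ^ 3))"
  proof -
    define v w where "v = 1 - m" and "w = 1 + m"
    have vw: "v > 0" "w > 0" "w \<ge> 1" using m m1 by (simp_all add: v_def w_def)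
    \<comment> \<open>The chord length is continuous in the intercept, so only its values 2, 2/w,
      2\<tau>/v, 0 at the break points enter.\<close>
    have "1 + (1 + \<tau> - ?b1) / (1 + m) = 2" "1 + (1 + \<tau> - ?b2) / (1 + m) = 2 / w"
      "(1 + \<tau> - ?b2) / (1 + m) + (1 + \<tau> - ?b2) / (1 - m) = 2 / w"
      "(1 + \<tau> - ?b3) / (1 + m) + (1 + \<tau> - ?b3) / (1 - m) = 2 * \<tau> / v"
      "(1 - ?b3) / m + (1 + \<tau> - ?b3) / (1 - m) = 2 * \<tau> / v"
      "(1 - ?b4) / m + (1 + \<tau> - ?b4) / (1 - m) = 0"
      using m m1 by (simp_all add: v_def w_def divide_simps) (simp_all add: algebra_simps)?
    note L = this
    have e: "- a / 30 * p - - a / 30 * q = a / 30 * (q - p)" for a p q :: real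
      by (simp add: right_diff_distrib)
    have F: "?F2 ?b2 - ?F2 ?b1 = w / 30 * (2 ^ 5 - (2 / w) ^ 5)"
      "?F3 ?b3 - ?F3 ?b2 = v * w / 60 * ((2 / w) ^ 5 - (2 * \<tau> / v) ^ 5)"
      "?F4 ?b4 - ?F4 ?b3 = m * v / 30 * (2 * \<tau> / v) ^ 5"
      unfolding L e by (simp_all add: v_def w_def)
    have "(2 / w) ^ 5 \<le> 2 ^ 5"
      using vw by (intro power_mono) (simp_all add: field_simps)
    \<comment> \<open>\<tau> w \<le> v is \<tau> + m \<le> 1 - \<tau> m again. These monotonicity
      facts make every summand nonnegative, as adding under \<open>ennreal\<close> requires.\<close>
    moreover have "(2 * \<tau> / v) ^ 5 \<le> (2 / w) ^ 5"
      using vw tau_bounds b2 by (intro power_mono) (simp_all add: field_simps v_def w_def)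
    ultimately have nn: "0 \<le> w / 30 * (2 ^ 5 - (2 / w) ^ 5)"
      "0 \<le> v * w / 60 * ((2 / w) ^ 5 - (2 * \<tau> / v) ^ 5)" "0 \<le> m * v / 30 * (2 * \<tau> / v) ^ 5"
      using vw m tau_bounds by simp_all
    have total: "2 * (16 / 6 * (\<tau> - m) + w / 30 * (2 ^ 5 - (2 / w) ^ 5)
          + v * w / 60 * ((2 / w) ^ 5 - (2 * \<tau> / v) ^ 5) + m * v / 30 * (2 * \<tau> / v) ^ 5)
        = 16 / 15 * (5 * \<tau> + 2 - 3 * m - 1 / w ^ 3 - \<tau> ^ 5 / v ^ 3)"
    proof -
      \<comment> \<open>In terms of w^-4 and v^-4 the collapse is linear: it rests on v - 2 = -w and
        w - 2 m = v.\<close>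
      obtain a b where ab: "a = 1 / w ^ 4" "b = 1 / v ^ 4" by blast
      have pw: "w / w ^ 5 = a" "v * w / w ^ 5 = v * a" "m * v / v ^ 5 = m * b" "v * w / v ^ 5 = w * b"
        "1 / w ^ 3 = w * a" "1 / v ^ 3 = v * b"
        using vw by (simp_all add: ab power_eq_if)
      have *: "2 * (16 / 6 * (\<tau> - m) + w / 30 * (2 ^ 5 - (2 / w) ^ 5)
          + v * w / 60 * ((2 / w) ^ 5 - (2 * \<tau> / v) ^ 5) + m * v / 30 * (2 * \<tau> / v) ^ 5)
        = 2 * (16 / 6 * (\<tau> - m) + 32 / 30 * w - 32 / 30 * (w / w ^ 5) + 32 / 60 * (v * w / w ^ 5)
          - 32 / 60 * \<tau> ^ 5 * (v * w / v ^ 5) + 32 / 30 * \<tau> ^ 5 * (m * v / v ^ 5))"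
        by (simp add: power_divide power_mult_distrib algebra_simps)
      have **: "16 / 15 * (5 * \<tau> + 2 - 3 * m - 1 / w ^ 3 - \<tau> ^ 5 / v ^ 3) =
         16 / 15 * (5 * \<tau> + 2 - 3 * m - 1 / w ^ 3 - \<tau> ^ 5 * (1 / v ^ 3))"
        by simp
      show ?thesis
        unfolding * ** unfolding pw by (simp add: v_def w_def field_simps)
    qed
    have split: "2 * (ennreal x1 + ennreal x2 + ennreal x3 + ennreal x4) = ennreal (2 * (x1 + x2 + x3 + x4))"
      if "0 \<le> x1" "0 \<le> x2" "0 \<le> x3" "0 \<le> x4" for x1 x2 x3 x4
      using that ennreal_mult'[of 2 "x1 + x2 + x3 + x4"] by (simp flip: ennreal_plus)
    have "0 \<le> 16 / 6 * (\<tau> - m)" using m by simp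
    note split = split[OF this nn]
    show ?thesis
      unfolding F unfolding mult_zero_right diff_zero split total by (simp only: v_def w_def)
  qed
  finally show ?thesis .
qed

section \<open>Integration over the slope\<close>

text \<open>Antiderivative of sqrt(1 + m^2) / (1 + m)^3. The substitution u = 1/(1 + m) turns the
  integral into that of -sqrt(2 u^2 - 2 u + 1); completing the square leads to z = 2 u - 1 = (1 -
  m)/(1 + m) and to \<open>arsinh\<close> z.\<close>

definition inv_cube_primitive :: "real \<Rightarrow> real" where
  "inv_cube_primitive m = sqrt (1 + m\<^sup>2) * ((1 / (1 + m)) / 4 - (1 / (1 + m))\<^sup>2 / 2)
     - arsinh ((1 - m) / (1 + m)) / (4 * sqrt 2)"

lemma has_real_derivative_sqrt_one_plus_square:
  "((\<lambda>m. sqrt (1 + m\<^sup>2)) has_real_derivative m / sqrt (1 + m\<^sup>2)) (at m)"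
proof -
  have "0 < 1 + m\<^sup>2" by (simp add: add_pos_nonneg)
  then show ?thesis by (auto intro!: derivative_eq_intros simp: field_simps)
qed

lemma has_real_derivative_inv_cube_primitive:
  assumes m: "-1 < m"
  shows "(inv_cube_primitive has_real_derivative sqrt (1 + m\<^sup>2) / (1 + m) ^ 3) (at m)"
proof -
  define R where "R = sqrt (1 + m\<^sup>2)"
  define w where "w = 1 + m"
  have w: "w > 0" using m by (simp add: w_def)
  have R2: "R\<^sup>2 = 1 + m\<^sup>2" and R: "R > 0"
    by (simp_all add: R_def add_pos_nonneg)
  have dR: "((\<lambda>m. sqrt (1 + m\<^sup>2)) has_real_derivative m / R) (at m)"
    unfolding R_def by (rule has_real_derivative_sqrt_one_plus_square)
  have "((1 - m) / (1 + m))\<^sup>2 + 1 = 2 * (R / w)\<^sup>2"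
    using w R2 by (simp add: power_divide w_def field_simps) (simp add: power2_eq_square algebra_simps)
  then have sq: "sqrt (((1 - m) / (1 + m))\<^sup>2 + 1) = sqrt 2 * (R / w)"
    using R w by (simp add: real_sqrt_mult)
  have d: "((\<lambda>m. (1 - m) / (1 + m)) has_real_derivative - 2 / w\<^sup>2) (at m)"
    using w by (auto intro!: derivative_eq_intros simp: w_def field_simps power2_eq_square)
  have d2: "((\<lambda>m. arsinh ((1 - m) / (1 + m))) has_real_derivative - sqrt 2 / (w * R)) (at m)"
  proof -
    have "((\<lambda>m. arsinh ((1 - m) / (1 + m))) has_real_derivative (1 / sqrt (((1 - m) / (1 + m))\<^sup>2 + 1)) * (- 2 / w\<^sup>2)) (at m)"
      by (rule DERIV_chain2[OF arsinh_real_has_field_derivative d])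
    also have "(1 / sqrt (((1 - m) / (1 + m))\<^sup>2 + 1)) * (- 2 / w\<^sup>2) = - sqrt 2 / (w * R)"
      unfolding sq using w R by (simp add: field_simps power2_eq_square flip: mult.assoc)
    finally show ?thesis .
  qed
  have dw: "((\<lambda>m. 1 / (1 + m)) has_real_derivative - 1 / w\<^sup>2) (at m)"
    using w by (auto intro!: derivative_eq_intros simp: w_def power2_eq_square)
  have d3: "((\<lambda>m. (1 / (1 + m)) / 4 - (1 / (1 + m))\<^sup>2 / 2) has_real_derivative 1 / w ^ 3 - 1 / (4 * w\<^sup>2)) (at m)"
  proof -
    have "((\<lambda>m. (1 / (1 + m)) / 4 - (1 / (1 + m))\<^sup>2 / 2) has_real_derivative
        (- 1 / w\<^sup>2) / 4 - (2 * (- 1 / w\<^sup>2 * (1 / w))) / 2) (at m)"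
      using DERIV_diff[OF DERIV_cdivide[OF dw, of 4] DERIV_cdivide[OF DERIV_power[OF dw, of 2], of 2]]
      by (simp add: w_def)
    also have "(- 1 / w\<^sup>2) / 4 - (2 * (- 1 / w\<^sup>2 * (1 / w))) / 2 = 1 / w ^ 3 - 1 / (4 * w\<^sup>2)"
      by (simp add: power2_eq_square power3_eq_cube)
    finally show ?thesis .
  qed
  have "(inv_cube_primitive has_real_derivative
    (m / R * ((1 / w) / 4 - (1 / w)\<^sup>2 / 2) + (1 / w ^ 3 - 1 / (4 * w\<^sup>2)) * R) - (- sqrt 2 / (w * R)) / (4 * sqrt 2)) (at m)"
    unfolding inv_cube_primitive_def[abs_def]
    using DERIV_diff[OF DERIV_mult[OF dR d3] DERIV_cdivide[OF d2, of "4 * sqrt 2"]]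
    by (simp add: R_def w_def)
  also have "(m / R * ((1 / w) / 4 - (1 / w)\<^sup>2 / 2) + (1 / w ^ 3 - 1 / (4 * w\<^sup>2)) * R) - (- sqrt 2 / (w * R)) / (4 * sqrt 2)
      = R / w ^ 3"
  proof -
    have "(m / R * ((1 / w) / 4 - (1 / w)\<^sup>2 / 2) + (1 / w ^ 3 - 1 / (4 * w\<^sup>2)) * R) - (- sqrt 2 / (w * R)) / (4 * sqrt 2)
      = (m * (w\<^sup>2 - 2 * w) + R\<^sup>2 * (4 - w) + w\<^sup>2) / (4 * R * w ^ 3)"
      using w R by (simp add: field_simps power2_eq_square power3_eq_cube)
    \<comment> \<open>With R^2 = 1 + m^2 and w = 1 + m everything but 4 R^2 cancels.\<close>
    also have "m * (w\<^sup>2 - 2 * w) + R\<^sup>2 * (4 - w) + w\<^sup>2 = 4 * R\<^sup>2"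
      unfolding R2 w_def by (simp add: power2_eq_square algebra_simps)
    also have "4 * R\<^sup>2 / (4 * R * w ^ 3) = R / w ^ 3"
      using R by (simp add: power2_eq_square)
    finally show ?thesis .
  qed
  finally show ?thesis by (simp add: R_def w_def)
qed

text \<open>Termwise antiderivative of sqrt(1 + m^2) times the bracket obtained from the intercepts.
  The last sign is plus because the inner map m -> -m has derivative -1.\<close>

definition energy_primitive :: "real \<Rightarrow> real" where
  "energy_primitive m = (5 * \<tau> + 2) * ((m * sqrt (1 + m\<^sup>2) + arsinh m) / 2) - sqrt (1 + m\<^sup>2) ^ 3
     - inv_cube_primitive m + \<tau> ^ 5 * inv_cube_primitive (- m)"

lemma has_real_derivative_energy_primitive:
  assumes m: "-1 < m" "m < 1"
  shows "(energy_primitive has_real_derivative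
    sqrt (1 + m\<^sup>2) * (5 * \<tau> + 2 - 3 * m - 1 / (1 + m) ^ 3 - \<tau> ^ 5 / (1 - m) ^ 3)) (at m)"
proof -
  define R where "R = sqrt (1 + m\<^sup>2)"
  have R2: "R\<^sup>2 = 1 + m\<^sup>2" and R: "R > 0"
    by (simp_all add: R_def add_pos_nonneg)
  have dR: "((\<lambda>m. sqrt (1 + m\<^sup>2)) has_real_derivative m / R) (at m)"
    unfolding R_def by (rule has_real_derivative_sqrt_one_plus_square)
  have dA: "(arsinh has_real_derivative 1 / R) (at m)"
    using arsinh_real_has_field_derivative[of m UNIV] by (simp add: R_def add.commute)
  have d1: "((\<lambda>m. (m * sqrt (1 + m\<^sup>2) + arsinh m) / 2) has_real_derivative R) (at m)"
  proof -
    have "((\<lambda>m. (m * sqrt (1 + m\<^sup>2) + arsinh m) / 2) has_real_derivative (1 * sqrt (1 + m\<^sup>2) + m / R * m + 1 / R) / 2) (at m)"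
      by (intro DERIV_cdivide DERIV_add DERIV_mult DERIV_ident dR dA)
    also have "(1 * sqrt (1 + m\<^sup>2) + m / R * m + 1 / R) / 2 = R"
      unfolding R_def[symmetric] using R R2 by (simp add: field_simps power2_eq_square)
    finally show ?thesis .
  qed
  have d2: "((\<lambda>m. sqrt (1 + m\<^sup>2) ^ 3) has_real_derivative 3 * m * R) (at m)"
  proof -
    have "((\<lambda>m. sqrt (1 + m\<^sup>2) ^ 3) has_real_derivative 3 * (m / R * R ^ 2)) (at m)"
      using DERIV_power[OF dR, of 3] by (simp add: R_def)
    also have "3 * (m / R * R ^ 2) = 3 * m * R" using R by (simp add: power2_eq_square)
    finally show ?thesis .
  qed
  have d3: "((\<lambda>m. inv_cube_primitive (- m)) has_real_derivative (R / (1 - m) ^ 3) * (- 1)) (at m)"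
    using has_real_derivative_inv_cube_primitive[of "- m"] m
    by (intro DERIV_chain2[of _ _ uminus]) (auto intro!: derivative_eq_intros simp: R_def)
  have "(energy_primitive has_real_derivative
      R * (5 * \<tau> + 2) - 3 * m * R - R / (1 + m) ^ 3 + (R / (1 - m) ^ 3) * (- 1) * \<tau> ^ 5) (at m)"
    unfolding energy_primitive_def[abs_def] mult.commute[of "5 * \<tau> + 2"] mult.commute[of "\<tau> ^ 5"]
    by (intro DERIV_add DERIV_diff DERIV_cmult_right d1 d2 d3)
       (use has_real_derivative_inv_cube_primitive[OF m(1)] in \<open>simp add: R_def\<close>)
  then show ?thesis
    by (simp add: R_def algebra_simps)
qed

text \<open>Both fractions are at most 1, the second since \<tau> \<le> 1 - m, while 5 \<tau> + 2 -
  3 m \<ge> 2.\<close>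

lemma energy_density_nonneg:
  assumes m: "0 \<le> m" "m \<le> \<tau>"
  shows "0 \<le> 5 * \<tau> + 2 - 3 * m - 1 / (1 + m) ^ 3 - \<tau> ^ 5 / (1 - m) ^ 3"
proof -
  have "1 / (1 + m) ^ 3 \<le> 1" using m by simp
  moreover have "\<tau> ^ 5 / (1 - m) ^ 3 \<le> 1"
  proof -
    have "\<tau> ^ 5 \<le> \<tau> ^ 3" using tau_bounds by (intro power_decreasing) auto
    also have "\<dots> \<le> (1 - m) ^ 3" using m tau_bounds by (intro power_mono) auto
    finally show ?thesis using m tau_bounds by simp
  qed
  ultimately show ?thesis using m by linarith
qed

lemma energy_primitive_le: "energy_primitive 0 \<le> energy_primitive \<tau>"
proof (rule DERIV_nonneg_imp_nondecreasing[where f = energy_primitive])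
  fix m assume m: "0 \<le> m" "m \<le> \<tau>"
  then show "\<exists>y. (energy_primitive has_real_derivative y) (at m) \<and> 0 \<le> y"
    using has_real_derivative_energy_primitive[of m] energy_density_nonneg[OF m] tau_bounds
    by (intro exI[of _ "sqrt (1 + m\<^sup>2) * (5 * \<tau> + 2 - 3 * m - 1 / (1 + m) ^ 3 - \<tau> ^ 5 / (1 - m) ^ 3)"])
       (auto intro!: mult_nonneg_nonneg)
qed (use tau_bounds in simp)

lemma pair_energy_octagon_sector:
  "pair_energy (\<lambda>v. indicator {v. \<bar>snd v\<bar> < \<tau> * \<bar>fst v\<bar>} v * ennreal (norm v)) octagon =
    ennreal (32 / 15 * (energy_primitive \<tau> - energy_primitive 0))"
proof -
  let ?K = "\<lambda>m. \<integral>\<^sup>+b. chord_energy (octagon_chord m b) \<partial>lborel"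
  let ?k = "\<lambda>m. 5 * \<tau> + 2 - 3 * m - 1 / (1 + m) ^ 3 - \<tau> ^ 5 / (1 - m) ^ 3"
  have K_even: "?K (- m) = ?K m" for m
    by (simp add: octagon_chord_uminus(1) chord_energy_uminus)
  have [measurable]: "?K \<in> borel_measurable borel"
    by measurable
  have "pair_energy (\<lambda>v. indicator {v. \<bar>snd v\<bar> < \<tau> * \<bar>fst v\<bar>} v * ennreal (norm v)) octagon =
    (\<integral>\<^sup>+m. indicator {-\<tau><..<\<tau>} m * ennreal (sqrt (1 + m\<^sup>2)) * ?K m \<partial>lborel)"
    unfolding octagon_chord_def by (rule pair_energy_lines) measurable
  also have "\<dots> = 2 * (\<integral>\<^sup>+m. indicator {0..} m * (indicator {-\<tau><..<\<tau>} m * ennreal (sqrt (1 + m\<^sup>2)) * ?K m) \<partial>lborel)"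
  proof (rule nn_integral_even)
    show "indicator {-\<tau><..<\<tau>} (- m) * ennreal (sqrt (1 + (- m)\<^sup>2)) * ?K (- m)
      = indicator {-\<tau><..<\<tau>} m * ennreal (sqrt (1 + m\<^sup>2)) * ?K m" for m
      unfolding K_even by (auto simp: indicator_def)
  qed measurable
  also have "(\<integral>\<^sup>+m. indicator {0..} m * (indicator {-\<tau><..<\<tau>} m * ennreal (sqrt (1 + m\<^sup>2)) * ?K m) \<partial>lborel)
    = (\<integral>\<^sup>+m. indicator {0..\<tau>} m * ennreal (16 / 15 * (sqrt (1 + m\<^sup>2) * ?k m)) \<partial>lborel)"
  proof (rule nn_integral_cong_AE)
    \<comment> \<open>At m = 0 the chord formula would divide by zero, and at m = \<tau> the open
      and the closed range differ.\<close>
    have ae: "AE m in lborel. m \<noteq> 0 \<and> m \<noteq> \<tau>"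
      by (intro AE_conjI AE_lborel_singleton)
    show "AE m in lborel. indicator {0..} m * (indicator {-\<tau><..<\<tau>} m * ennreal (sqrt (1 + m\<^sup>2)) * ?K m)
      = indicator {0..\<tau>} m * ennreal (16 / 15 * (sqrt (1 + m\<^sup>2) * ?k m))"
    proof (rule eventually_mono[OF ae])
      fix m assume "m \<noteq> 0 \<and> m \<noteq> \<tau>"
      then consider "m < 0" | "\<tau> < m" | "0 < m" "m < \<tau>" by linarith
      then show "indicator {0..} m * (indicator {-\<tau><..<\<tau>} m * ennreal (sqrt (1 + m\<^sup>2)) * ?K m)
        = indicator {0..\<tau>} m * ennreal (16 / 15 * (sqrt (1 + m\<^sup>2) * ?k m))"
      proof cases
        case 3
        then have "?K m = ennreal (16 / 15 * ?k m)"
          by (rule nn_integral_octagon_chord_energy)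
        moreover have "0 \<le> ?k m" using 3 energy_density_nonneg by simp
        ultimately show ?thesis
          using 3 tau_bounds by (simp only:) (simp add: mult_ac flip: ennreal_mult')
      qed simp_all
    qed
  qed
  also have "\<dots> = ennreal (16 / 15 * energy_primitive \<tau> - 16 / 15 * energy_primitive 0)"
  proof (rule nn_integral_Icc)
    fix m assume "0 \<le> m" "m \<le> \<tau>"
    then show "0 \<le> 16 / 15 * (sqrt (1 + m\<^sup>2) * ?k m)"
      using energy_density_nonneg by (intro mult_nonneg_nonneg) auto
    show "((\<lambda>m. 16 / 15 * energy_primitive m) has_real_derivative 16 / 15 * (sqrt (1 + m\<^sup>2) * ?k m)) (at m)"
      using \<open>0 \<le> m\<close> \<open>m \<le> \<tau>\<close> tau_bounds by (intro DERIV_cmult has_real_derivative_energy_primitive) auto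
  qed (use tau_bounds in simp_all)
  also have "2 * \<dots> = ennreal (32 / 15 * (energy_primitive \<tau> - energy_primitive 0))"
    by (subst ennreal_numeral[symmetric], subst ennreal_mult'[symmetric]) (simp_all add: right_diff_distrib)
  finally show ?thesis .
qed

section \<open>Reduction to one double sector of directions\<close>

lemma pair_energy_add:
  assumes [measurable]: "f \<in> borel_measurable borel" "g \<in> borel_measurable borel" "S \<in> sets borel"
  shows "pair_energy (\<lambda>v. f v + g v) S = pair_energy f S + pair_energy g S"
  unfolding pair_energy_def by (simp add: distrib_left nn_integral_add)

text \<open>Meant for the lines bounding the double sectors, where the four sector indicators fail
  to add up to 1.\<close>

lemma pair_energy_cong_AE:
  assumes "\<And>p. AE q in lborel. f (q - p) = g (q - p)"
  shows "pair_energy f S = pair_energy g S"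
  unfolding pair_energy_def
proof (rule nn_integral_cong)
  fix p
  show "(\<integral>\<^sup>+q. indicator S p * indicator S q * f (q - p) \<partial>lborel) =
    (\<integral>\<^sup>+q. indicator S p * indicator S q * g (q - p) \<partial>lborel)"
    by (rule nn_integral_cong_AE, rule eventually_mono[OF assms[of p]]) simp
qed

lemma AE_lborel_inner_neq:
  fixes a :: "'a::euclidean_space"
  assumes "a \<noteq> 0"
  shows "AE x in lborel. a \<bullet> x \<noteq> b"
proof -
  have "negligible {x. a \<bullet> x = b}"
    using assms by (intro negligible_hyperplane) simp
  then have "{x. a \<bullet> x = b} \<in> null_sets lborel"
    by (simp add: negligible_iff_null_sets null_sets_completion_iff closed_hyperplane)
  then show ?thesis
    by (intro AE_I'[of "{x. a \<bullet> x = b}"]) auto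
qed

text \<open>Off the four lines \<open>y = \<plusminus>\<tau> x\<close>, \<open>x = \<plusminus>\<tau> y\<close> the plane is the union of the double sector
  \<open>\<bar>y\<bar> < \<tau> \<bar>x\<bar>\<close> and its images under rotation by multiples of \<open>\<pi>/4\<close>.\<close>

lemma double_sectors_partition:
  fixes x y :: real
  assumes "y \<noteq> \<tau> * x" "y \<noteq> - \<tau> * x" "x \<noteq> \<tau> * y" "x \<noteq> - \<tau> * y"
  shows "of_bool (\<bar>y\<bar> < \<tau> * \<bar>x\<bar>) + of_bool (\<bar>x + y\<bar> < \<tau> * \<bar>x - y\<bar>)
    + of_bool (\<bar>x\<bar> < \<tau> * \<bar>y\<bar>) + of_bool (\<bar>x - y\<bar> < \<tau> * \<bar>x + y\<bar>) = (1 :: ennreal)"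
proof -
  \<comment> \<open>In the first quadrant the sector around (1, -1) is absent. The other quadrants
    follow by sign changes; changing just one sign exchanges the two diagonal sectors.\<close>
  have quadrant: "of_bool (y < \<tau> * x) + of_bool (x + y < \<tau> * \<bar>x - y\<bar>)
    + of_bool (x < \<tau> * y) + of_bool (\<bar>x - y\<bar> < \<tau> * (x + y)) = (1 :: ennreal)"
    if "0 \<le> x" "0 \<le> y" "y \<noteq> \<tau> * x" "x \<noteq> \<tau> * y" for x y :: real
  proof -
    \<comment> \<open>Because \<tau> + \<tau>^2 = 1 - \<tau>, the sector around the diagonal ends
      exactly on the edge of its neighbour.\<close>
    have less: "u - v < \<tau> * (u + v) \<longleftrightarrow> \<tau> * u < v" for u v :: real
    proof -
      have "(1 + \<tau>) * (\<tau> * u) = (\<tau> + \<tau>\<^sup>2) * u"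
        by (simp add: power2_eq_square algebra_simps)
      also have "\<dots> = u - \<tau> * u"
        unfolding tau_square by (simp add: algebra_simps)
      finally have "u - v < \<tau> * (u + v) \<longleftrightarrow> (1 + \<tau>) * (\<tau> * u) < (1 + \<tau>) * v"
        by (simp only:) (auto simp: algebra_simps)
      then show ?thesis using tau_bounds by simp
    qed
    have "\<tau> * \<bar>x - y\<bar> \<le> 1 * \<bar>x - y\<bar>" using tau_bounds by (intro mult_right_mono) auto
    then have "\<not> x + y < \<tau> * \<bar>x - y\<bar>" using that by auto
    moreover have "\<bar>x - y\<bar> < \<tau> * (x + y) \<longleftrightarrow> \<tau> * x < y \<and> \<tau> * y < x"
      using less[of x y] less[of y x] by (auto simp: abs_less_iff add.commute)
    moreover have "\<tau> * x \<le> x" "\<tau> * y \<le> y"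
      using tau_bounds that mult_right_mono[of \<tau> 1] by auto
    ultimately show ?thesis
      using that by (cases "y < \<tau> * x"; cases "x < \<tau> * y") auto
  qed
  consider "0 \<le> x" "0 \<le> y" | "0 \<le> x" "y \<le> 0" | "x \<le> 0" "0 \<le> y" | "x \<le> 0" "y \<le> 0"
    by linarith
  then show ?thesis
  proof cases
    case 1 then show ?thesis using quadrant[of x y] assms by simp
  next
    case 2 then show ?thesis using quadrant[of x "- y"] assms by (simp add: add_ac)
  next
    case 3
    then have "\<bar>x + y\<bar> = \<bar>- x - y\<bar>" "\<bar>x - y\<bar> = - x + y" by auto
    then show ?thesis using quadrant[of "- x" y] assms 3 by (simp add: add_ac)
  next
    case 4
    then have "\<bar>x + y\<bar> = - x - y" "\<bar>x - y\<bar> = \<bar>- x + y\<bar>" by auto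
    then show ?thesis using quadrant[of "- x" "- y"] assms 4 by (simp add: add_ac)
  qed
qed

section \<open>Invariance under the turn by pi/4\<close>

definition turn8 :: "real \<times> real \<Rightarrow> real \<times> real" where
  "turn8 = rot (1 / sqrt 2) (1 / sqrt 2)"

text \<open>The turn exchanges upright and slanted sides: |x - y| and |x + y| have maximum |x| + |y|
  and sum 2 max(|x|, |y|).\<close>

lemma turn8_octagon: "{p. turn8 p \<in> octagon} = octagon"
proof -
  have "turn8 (x, y) \<in> octagon \<longleftrightarrow> (x, y) \<in> octagon" for x y
  proof -
    have "turn8 (x, y) \<in> octagon \<longleftrightarrow>
      \<bar>x - y\<bar> / sqrt 2 \<le> 1 \<and> \<bar>x + y\<bar> / sqrt 2 \<le> 1 \<and> \<bar>x - y\<bar> / sqrt 2 + \<bar>x + y\<bar> / sqrt 2 \<le> 1 + \<tau>"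
      by (simp add: turn8_def rot_def mem_octagon abs_divide flip: diff_divide_distrib add_divide_distrib)
    also have "\<dots> \<longleftrightarrow> \<bar>x - y\<bar> \<le> sqrt 2 \<and> \<bar>x + y\<bar> \<le> sqrt 2 \<and> \<bar>x - y\<bar> + \<bar>x + y\<bar> \<le> sqrt 2 * sqrt 2"
      by (simp add: \<tau>_def divide_le_eq flip: add_divide_distrib)
    also have "\<dots> \<longleftrightarrow> \<bar>x\<bar> \<le> 1 \<and> \<bar>y\<bar> \<le> 1 \<and> \<bar>x\<bar> + \<bar>y\<bar> \<le> sqrt 2"
      unfolding real_sqrt_mult_self by auto
    finally show ?thesis by (simp add: mem_octagon \<tau>_def)
  qed
  then show ?thesis by auto
qed

lemma turn8_measurable [measurable]: "turn8 \<in> borel \<rightarrow>\<^sub>M borel"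
  unfolding turn8_def by measurable

lemma norm_turn8: "norm (turn8 v) = norm v"
  unfolding turn8_def by (rule norm_rot) (simp add: power_divide)

lemma pair_energy_turn8:
  assumes "w \<in> borel_measurable borel"
  shows "pair_energy (\<lambda>v. w (turn8 v)) octagon = pair_energy w octagon"
  using pair_energy_similarity[OF assms octagon_measurable, of 1 "1 / sqrt 2" "1 / sqrt 2" 0]
  by (simp add: turn8_octagon power_divide flip: turn8_def)

lemma pair_energy_octagon_eq_sector:
  "pair_energy (\<lambda>v. ennreal (norm v)) octagon =
    4 * pair_energy (\<lambda>v. indicator {v. \<bar>snd v\<bar> < \<tau> * \<bar>fst v\<bar>} v * ennreal (norm v)) octagon"
proof -
  define w where "w v = indicator {v. \<bar>snd v\<bar> < \<tau> * \<bar>fst v\<bar>} v * ennreal (norm v)" for v :: "real \<times> real"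
  have w [measurable]: "w \<in> borel_measurable borel"
    unfolding w_def borel_prod[symmetric] norm_prod_def by measurable
  \<comment> \<open>Double sectors are centrally symmetric, so the turns by 0, pi/4, pi/2 and 3 pi/4
    suffice.\<close>
  let ?W = "\<lambda>v. w v + w (turn8 v) + w (turn8 (turn8 v)) + w (turn8 (turn8 (turn8 v)))"
  have W: "ennreal (norm v) = ?W v"
    if "(- \<tau>, 1) \<bullet> v \<noteq> 0" "(\<tau>, 1) \<bullet> v \<noteq> 0" "(1, - \<tau>) \<bullet> v \<noteq> 0" "(1, \<tau>) \<bullet> v \<noteq> 0" for v
  proof -
    obtain x y where v: "v = (x, y)" by (cases v)
    have t1: "turn8 v = ((x - y) / sqrt 2, (x + y) / sqrt 2)"
      by (simp add: v turn8_def rot_def diff_divide_distrib add_divide_distrib)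
    have t2: "turn8 (turn8 v) = (- y, x)"
      by (simp add: v turn8_def rot_def field_simps)
    have t3: "turn8 (turn8 (turn8 v)) = (- ((x + y) / sqrt 2), (x - y) / sqrt 2)"
      unfolding t2 by (simp add: turn8_def rot_def diff_divide_distrib add_divide_distrib)
    have div: "\<bar>a / sqrt 2\<bar> < \<tau> * \<bar>b / sqrt 2\<bar> \<longleftrightarrow> \<bar>a\<bar> < \<tau> * \<bar>b\<bar>" for a b
      by (simp add: abs_divide divide_less_cancel)
    have w': "w u = of_bool (\<bar>snd u\<bar> < \<tau> * \<bar>fst u\<bar>) * ennreal (norm u)" for u
      by (simp add: w_def indicator_def)
    have "?W v = (of_bool (\<bar>y\<bar> < \<tau> * \<bar>x\<bar>) + of_bool (\<bar>x + y\<bar> < \<tau> * \<bar>x - y\<bar>)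
       + of_bool (\<bar>x\<bar> < \<tau> * \<bar>y\<bar>) + of_bool (\<bar>x - y\<bar> < \<tau> * \<bar>x + y\<bar>)) * ennreal (norm v)"
      unfolding w' norm_turn8 unfolding t3 unfolding t2 unfolding t1 fst_conv snd_conv abs_minus_cancel div
      by (simp add: v distrib_right)
    also have "\<dots> = ennreal (norm v)"
    proof -
      have "y \<noteq> \<tau> * x" "y \<noteq> - \<tau> * x" "x \<noteq> \<tau> * y" "x \<noteq> - \<tau> * y"
        using that unfolding v by auto
      then show ?thesis
        unfolding double_sectors_partition[OF \<open>y \<noteq> \<tau> * x\<close> \<open>y \<noteq> - \<tau> * x\<close> \<open>x \<noteq> \<tau> * y\<close> \<open>x \<noteq> - \<tau> * y\<close>] by simp
    qed
    finally show ?thesis by simp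
  qed
  have "pair_energy (\<lambda>v. ennreal (norm v)) octagon = pair_energy ?W octagon"
  proof (rule pair_energy_cong_AE)
    fix p :: "real \<times> real"
    \<comment> \<open>The exceptional \<open>q\<close> lie on the four sector boundaries translated
      to \<open>p\<close>.\<close>
    have ae: "AE q in lborel. (- \<tau>, 1) \<bullet> q \<noteq> (- \<tau>, 1) \<bullet> p \<and> (\<tau>, 1) \<bullet> q \<noteq> (\<tau>, 1) \<bullet> p \<and>
       (1, - \<tau>) \<bullet> q \<noteq> (1, - \<tau>) \<bullet> p \<and> (1, \<tau>) \<bullet> q \<noteq> (1, \<tau>) \<bullet> p"
      by (intro AE_conjI AE_lborel_inner_neq) (simp_all add: zero_prod_def)
    show "AE q in lborel. ennreal (norm (q - p)) = ?W (q - p)"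
      by (rule eventually_mono[OF ae], rule W) (simp_all add: inner_diff_right del: inner_Pair)
  qed
  also have "\<dots> = 4 * pair_energy w octagon"
  proof -
    have "pair_energy ?W octagon = pair_energy w octagon + pair_energy (\<lambda>v. w (turn8 v)) octagon
      + pair_energy (\<lambda>v. w (turn8 (turn8 v))) octagon + pair_energy (\<lambda>v. w (turn8 (turn8 (turn8 v)))) octagon"
      by (simp add: pair_energy_add)
    also have "pair_energy (\<lambda>v. w (turn8 (turn8 v))) octagon = pair_energy w octagon"
      using pair_energy_turn8[of "\<lambda>v. w (turn8 v)"] pair_energy_turn8[of w] by simp
    also have "pair_energy (\<lambda>v. w (turn8 (turn8 (turn8 v)))) octagon = pair_energy w octagon"
      using pair_energy_turn8[of "\<lambda>v. w (turn8 (turn8 v))"] pair_energy_turn8[of "\<lambda>v. w (turn8 v)"]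
        pair_energy_turn8[of w] by simp
    also have "pair_energy (\<lambda>v. w (turn8 v)) octagon = pair_energy w octagon"
      by (simp add: pair_energy_turn8)
    also have "e + e + e + e = 4 * e" for e :: ennreal
    proof -
      have "e + e + e + e = (1 + 1 + 1 + 1) * e" by (simp only: distrib_right mult_1_left)
      then show ?thesis by simp
    qed
    finally show ?thesis .
  qed
  finally show ?thesis by (simp only: w_def[abs_def])
qed

section \<open>The regular octagon as a polygon\<close>

text \<open>For the inclusion into the hull, every point lies on a horizontal segment whose ends
  divide two sides, hence are convex combinations of two vertices each.\<close>

lemma octagon_eq_convex_hull:
  "octagon = convex hull {(1, \<tau>), (\<tau>, 1), (- \<tau>, 1), (-1, \<tau>), (-1, - \<tau>), (- \<tau>, -1), (\<tau>, -1), (1, - \<tau>)}"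
    (is "_ = convex hull ?V")
proof
  have "?V \<subseteq> octagon"
    using tau_bounds by (auto simp: mem_octagon)
  then show "convex hull ?V \<subseteq> octagon"
    by (rule hull_minimal) (rule convex_octagon)
  have V: "(1, \<tau>) \<in> convex hull ?V" "(\<tau>, 1) \<in> convex hull ?V"
    "(- \<tau>, 1) \<in> convex hull ?V" "(-1, \<tau>) \<in> convex hull ?V"
    "(-1, - \<tau>) \<in> convex hull ?V" "(- \<tau>, -1) \<in> convex hull ?V"
    "(\<tau>, -1) \<in> convex hull ?V" "(1, - \<tau>) \<in> convex hull ?V"
    by (rule hull_inc, simp)+
  have segment: "(x, y) \<in> convex hull ?V"
    if "(a, a') \<in> convex hull ?V" "(b, b') \<in> convex hull ?V" "0 \<le> k" "k \<le> 1"
      "x = a + k * (b - a)" "y = a' + k * (b' - a')" for a a' b b' k x y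
  proof -
    have "(x, y) = (1 - k) *\<^sub>R (a, a') + k *\<^sub>R (b, b')"
      using that by (simp add: algebra_simps)
    then show ?thesis
      using convexD_alt[OF convex_convex_hull that(1,2,3,4)] by (simp only:)
  qed
  have horizontal: "(x, y) \<in> convex hull ?V"
    if lu: "(l, y) \<in> convex hull ?V" "(u, y) \<in> convex hull ?V" and x: "l \<le> x" "x \<le> u" for l u x y
  proof (cases "l = u")
    case False
    then show ?thesis
      using x by (intro segment[OF lu, of "(x - l) / (u - l)"]) (simp_all add: field_simps)
  qed (use lu x in auto)
  show "octagon \<subseteq> convex hull ?V"
  proof safe
    fix x y assume xy: "(x, y) \<in> octagon"
    consider "\<bar>y\<bar> \<le> \<tau>" | "\<tau> < y" | "y < - \<tau>" by linarith
    then show "(x, y) \<in> convex hull ?V"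
    proof cases
      case 1
      have "(-1, y) \<in> convex hull ?V"
        using 1 tau_bounds by (intro segment[OF V(5) V(4), of "(y + \<tau>) / (2 * \<tau>)"]) (auto simp: field_simps)
      moreover have "(1, y) \<in> convex hull ?V"
        using 1 tau_bounds by (intro segment[OF V(8) V(1), of "(y + \<tau>) / (2 * \<tau>)"]) (auto simp: field_simps)
      ultimately show ?thesis
        using xy by (intro horizontal[of "-1" y 1 x]) (auto simp: mem_octagon)
    next
      case 2
      \<comment> \<open>Relative height of y between the ends of a slanted side, at heights \<tau>
        and 1.\<close>
      define k where "k = (y - \<tau>) / (1 - \<tau>)"
      have k: "0 \<le> k" "k \<le> 1" "k * (1 - \<tau>) = y - \<tau>"
        using 2 xy tau_bounds by (auto simp: k_def mem_octagon)
      then have k': "k * (\<tau> - 1) = \<tau> - y" by (simp add: algebra_simps)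
      have "(- (1 + \<tau> - y), y) \<in> convex hull ?V"
        using k k' by (intro segment[OF V(4) V(3), of k]) auto
      moreover have "(1 + \<tau> - y, y) \<in> convex hull ?V"
        using k k' by (intro segment[OF V(1) V(2), of k]) auto
      ultimately show ?thesis
        using 2 xy by (intro horizontal[of "- (1 + \<tau> - y)" y "1 + \<tau> - y" x]) (auto simp: mem_octagon)
    next
      case 3
      define k where "k = (- y - \<tau>) / (1 - \<tau>)"
      have k: "0 \<le> k" "k \<le> 1" "k * (1 - \<tau>) = - y - \<tau>"
        using 3 xy tau_bounds by (auto simp: k_def mem_octagon)
      then have k': "k * (\<tau> - 1) = \<tau> + y" by (simp add: algebra_simps)
      have "(- (1 + \<tau> + y), y) \<in> convex hull ?V"
        using k k' by (intro segment[OF V(5) V(6), of k]) auto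
      moreover have "(1 + \<tau> + y, y) \<in> convex hull ?V"
        using k k' by (intro segment[OF V(8) V(7), of k]) auto
      ultimately show ?thesis
        using 3 xy by (intro horizontal[of "- (1 + \<tau> + y)" y "1 + \<tau> + y" x]) (auto simp: mem_octagon)
    qed
  qed
qed

lemma tan_pi_eighth: "tan (pi / 8) = \<tau>"
proof -
  have "sqrt 2 / 2 + 1 \<noteq> (0 :: real)"
    by (simp add: add_nonneg_pos less_imp_neq[symmetric])
  then have e: "sqrt 2 / 2 / (sqrt 2 / 2 + 1) = sqrt 2 - 1"
    by (subst nonzero_divide_eq_eq) (simp_all add: field_simps)
  have "2 * (pi / 8) = pi / 4" by simp
  from tan_half[of "pi / 8", unfolded this sin_45 cos_45 e] show ?thesis
    by (simp only: \<tau>_def)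
qed

text \<open>The vertex (1, \<tau>) has polar angle pi/8 and modulus 1 / cos(pi/8); this fixes both
  the scale and the angle of the rotation.\<close>

lemma regular_octagon_eq_image:
  "regular_polygon 8 r c \<theta> =
    (\<lambda>p. c + (r * cos (pi / 8)) *\<^sub>R rot (cos (\<theta> - pi / 8)) (sin (\<theta> - pi / 8)) p) ` octagon"
proof -
  define s \<phi> where "s = r * cos (pi / 8)" and "\<phi> = \<theta> - pi / 8"
  let ?T = "\<lambda>p. c + s *\<^sub>R rot (cos \<phi>) (sin \<phi>) p"
  \<comment> \<open>\<open>u k\<close> is (1, \<tau>) turned by k pi/4.\<close>
  define u where "u k = (cos (real k * (pi / 4)) - \<tau> * sin (real k * (pi / 4)),
    sin (real k * (pi / 4)) + \<tau> * cos (real k * (pi / 4)))" for k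
  have c8: "cos (pi / 8) > 0" by (rule cos_gt_zero) auto
  then have s8: "sin (pi / 8) = \<tau> * cos (pi / 8)"
    using tan_pi_eighth by (simp add: tan_def field_simps)
  have vertex: "c + (r * cos (\<theta> + 2 * pi * real k / real 8), r * sin (\<theta> + 2 * pi * real k / real 8)) = ?T (u k)" for k
  proof -
    have angle: "\<theta> + 2 * pi * real k / real 8 = \<phi> + (pi / 8 + real k * (pi / 4))"
      by (simp add: \<phi>_def)
    show ?thesis
      unfolding angle cos_add sin_add s8 by (simp add: u_def rot_def s_def algebra_simps)
  qed
  have u0: "u 0 = (1, \<tau>)" by (simp add: u_def)
  \<comment> \<open>One turn by pi/4 per step produces all vertices from the first, with only sin
    and cos of pi/4 to evaluate.\<close>
  have uSuc: "u (Suc k) = ((fst (u k) - snd (u k)) / sqrt 2, (fst (u k) + snd (u k)) / sqrt 2)" for k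
  proof -
    define \<alpha> where "\<alpha> = real k * (pi / 4)"
    have Suc: "real (Suc k) * (pi / 4) = \<alpha> + pi / 4" by (simp add: \<alpha>_def algebra_simps)
    show ?thesis
      unfolding u_def Suc \<alpha>_def[symmetric] cos_add sin_add cos_45 sin_45 by (simp add: field_simps)
  qed
  have q: "(1 - \<tau>) / sqrt 2 = \<tau>" "(1 + \<tau>) / sqrt 2 = 1"
    by (simp_all add: \<tau>_def field_simps)
  have q': "(\<tau> - 1) / sqrt 2 = - \<tau>" "(- 1 - \<tau>) / sqrt 2 = - 1" "(\<tau> + 1) / sqrt 2 = 1" "(- \<tau> - 1) / sqrt 2 = - 1" "(- 1 + \<tau>) / sqrt 2 = - \<tau>" "(- \<tau> + 1) / sqrt 2 = \<tau>"
    by (simp_all add: \<tau>_def field_simps)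
  have u1: "u 1 = (\<tau>, 1)" using uSuc[of 0] by (simp add: u0 q)
  have u2: "u 2 = (- \<tau>, 1)" using uSuc[of 1, unfolded u1] by (simp add: q q' numeral_2_eq_2)
  have u3: "u 3 = (- 1, \<tau>)" using uSuc[of 2, unfolded u2] by (simp add: q q')
  have u4: "u 4 = (- 1, - \<tau>)" using uSuc[of 3, unfolded u3] by (simp add: q q')
  have u5: "u 5 = (- \<tau>, - 1)" using uSuc[of 4, unfolded u4] by (simp add: q q')
  have u6: "u 6 = (\<tau>, - 1)" using uSuc[of 5, unfolded u5] by (simp add: q q')
  have u7: "u 7 = (1, - \<tau>)" using uSuc[of 6, unfolded u6] by (simp add: q q')
  have "{..<8} = {0, 1, 2, 3, 4, 5, 6, 7 :: nat}" by auto
  then have "u ` {..<8} = {(1, \<tau>), (\<tau>, 1), (- \<tau>, 1), (-1, \<tau>), (-1, - \<tau>), (- \<tau>, -1), (\<tau>, -1), (1, - \<tau>)}"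
    by (simp only: image_insert image_empty u0 u1 u2 u3 u4 u5 u6 u7)
  then have oct: "octagon = convex hull (u ` {..<8})"
    by (simp only: octagon_eq_convex_hull)
  have lin: "linear (\<lambda>p. s *\<^sub>R rot (cos \<phi>) (sin \<phi>) p)"
    by (rule linearI) (simp_all add: rot_def algebra_simps)
  have "regular_polygon 8 r c \<theta> = convex hull ((\<lambda>k. ?T (u k)) ` {..<8})"
    unfolding regular_polygon_def vertex ..
  also have "(\<lambda>k. ?T (u k)) ` {..<8} = (+) c ` (\<lambda>p. s *\<^sub>R rot (cos \<phi>) (sin \<phi>) p) ` u ` {..<8}"
    by (simp add: image_image)
  also have "convex hull \<dots> = ?T ` octagon"
    unfolding convex_hull_translation convex_hull_linear_image[OF lin, symmetric] oct by (simp add: image_image)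
  finally show ?thesis by (simp only: s_def \<phi>_def)
qed

lemma cos_pi_eighth: "cos (pi / 8) = 1 / sqrt (1 + \<tau>\<^sup>2)"
proof -
  have c: "cos (pi / 8) > 0" by (rule cos_gt_zero) auto
  then have "1 + \<tau>\<^sup>2 = (inverse (cos (pi / 8)))\<^sup>2"
    using tan_sec[of "pi / 8"] by (simp add: tan_pi_eighth)
  then show ?thesis using c by (simp add: inverse_eq_divide)
qed

text \<open>The energy scales with s^5 (two areas and one distance), the squared area with s^4. The
  constant is (4 * 32/15) / (8 \<tau>)^2.\<close>

lemma mean_distance_regular_octagon:
  assumes r: "r > 0"
  shows "mean_distance (regular_polygon 8 r c \<theta>) / r =
    cos (pi / 8) * (2 * (energy_primitive \<tau> - energy_primitive 0) / (15 * \<tau>\<^sup>2))"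
proof -
  define s a b where "s = r * cos (pi / 8)" and "a = cos (\<theta> - pi / 8)" and "b = sin (\<theta> - pi / 8)"
  let ?T = "\<lambda>p. c + s *\<^sub>R rot a b p" and ?P = "regular_polygon 8 r c \<theta>"
  define D where "D = energy_primitive \<tau> - energy_primitive 0"
  have s: "s > 0"
    unfolding s_def using r by (intro mult_pos_pos cos_gt_zero) auto
  then have s0: "s \<noteq> 0" by simp
  have ab: "a\<^sup>2 + b\<^sup>2 = 1" by (simp add: a_def b_def)
  have P: "?P = ?T ` octagon"
    unfolding regular_octagon_eq_image s_def a_def b_def ..
  have "inj ?T"
  proof (rule injI)
    fix p q assume "?T p = ?T q"
    then have "rot a b p - rot a b q = 0" using s0 by simp
    then have "norm (p - q) = 0" using norm_rot[OF ab, of "p - q"] by (simp add: rot_diff)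
    then show "p = q" by simp
  qed
  then have P': "{p. ?T p \<in> ?P} = octagon"
    unfolding P by (auto dest: injD)
  have "compact ?P"
    unfolding regular_polygon_def by (intro finite_imp_compact_convex_hull) simp
  then have meas [measurable]: "?P \<in> sets borel"
    by (intro borel_closed compact_imp_closed)
  have "emeasure lborel ?P = ennreal (s\<^sup>2) * (\<integral>\<^sup>+p. indicator ?P (?T p) \<partial>lborel)"
    using nn_integral_similarity[OF _ s0 ab, of "indicator ?P" c] by simp
  also have "(\<lambda>p. indicator ?P (?T p) :: ennreal) = indicator octagon"
    by (subst P'[symmetric]) (simp add: indicator_def fun_eq_iff)
  also have "ennreal (s\<^sup>2) * (\<integral>\<^sup>+p. indicator octagon p \<partial>lborel) = ennreal (s\<^sup>2 * (8 * \<tau>))"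
    by (simp add: emeasure_octagon ennreal_mult')
  finally have area: "emeasure lborel ?P = ennreal (s\<^sup>2 * (8 * \<tau>))" .
  have "pair_energy (\<lambda>v. ennreal (norm v)) ?P
      = ennreal (s ^ 4) * pair_energy (\<lambda>v. ennreal (norm (s *\<^sub>R rot a b v))) octagon"
    using pair_energy_similarity[OF _ meas s0 ab, of "\<lambda>v. ennreal (norm v)" c] by (simp add: P')
  also have "(\<lambda>v. ennreal (norm (s *\<^sub>R rot a b v))) = (\<lambda>v. ennreal s * ennreal (norm v))"
    using s by (simp add: norm_rot[OF ab] ennreal_mult')
  also have "pair_energy \<dots> octagon = ennreal s * pair_energy (\<lambda>v. ennreal (norm v)) octagon"
    unfolding pair_energy_def
    by (simp add: mult.left_commute[of _ "ennreal s"] nn_integral_cmult)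
  also have "pair_energy (\<lambda>v. ennreal (norm v)) octagon = ennreal (128 / 15 * D)"
    unfolding pair_energy_octagon_eq_sector pair_energy_octagon_sector
    using ennreal_mult'[of 4 "32 / 15 * D"] by (simp add: D_def)
  also have "ennreal (s ^ 4) * (ennreal s * ennreal (128 / 15 * D)) = ennreal (s ^ 5 * (128 / 15 * D))"
  proof -
    have "s ^ 5 * x = s ^ 4 * (s * x)" for x by (simp add: power_eq_if)
    then show ?thesis using s by (simp only: ennreal_mult' zero_le_power less_imp_le)
  qed
  finally have energy: "pair_energy (\<lambda>v. ennreal (norm v)) ?P = ennreal (s ^ 5 * (128 / 15 * D))" .
  have "mean_distance ?P = s ^ 5 * (128 / 15 * D) / (s\<^sup>2 * (8 * \<tau>))\<^sup>2"
    using s tau_bounds energy_primitive_le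
    by (intro mean_distance_eq_pair_energy meas area energy) (simp_all add: D_def)
  also have "\<dots> = s * (2 * D / (15 * \<tau>\<^sup>2))"
    using s0 by (simp add: power_mult_distrib power_eq_if)
  finally show ?thesis
    using r by (simp add: s_def D_def)
qed

section \<open>Evaluation of the closed form\<close>

theorem mainTheorem5:
  fixes r \<theta> :: real and c :: "real \<times> real"
  assumes "r > 0"
  shows "mean_distance (regular_polygon 8 r c \<theta>) / r =
    4 * sqrt 2 * pi / 3 + 2 * sqrt (2 - sqrt 2) *
     (1 / 5 + 13 * sqrt 2 / 120
      - (1 / 20 + sqrt 2 / 60 + 2 * pi / 3) * sqrt (2 + sqrt 2)
      - 1 / 48 * (14 + 91 * sqrt 2 / 10) * ln (2 + sqrt 2)
      + 1 / 48 * (1 + 7 * sqrt 2 / 10) * ln (2 - sqrt 2)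
      + 1 / 20 * (1 / 3 - sqrt 2 / 4) * ln (2 + sqrt (2 + sqrt 2))
      + 1 / 40 * (21 + 29 * sqrt 2 / 2) * ln (2 + sqrt (2 - sqrt 2)))"
proof -
  \<comment> \<open>Both sides become linear in \<open>a\<close>, \<open>b\<close>,
    \<open>l\<close>, \<open>l2\<close> and pi, with coefficients polynomial in \<open>q\<close> and
    \<open>\<rho>\<close>; \<rho> = 1 / cos(pi/8).\<close>
  define q \<rho> where "q = sqrt 2" and "\<rho> = sqrt (1 + \<tau>\<^sup>2)"
  define a b l l2 where "a = ln (\<tau> + \<rho>)" and "b = ln (1 + \<rho>)" and "l = ln \<tau>" and "l2 = ln (2 :: real)"
  \<comment> \<open>The second form also reduces products nested to the right, as
    \<open>algebra_simps\<close> leaves them.\<close>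
  have qq: "q * q = 2" "q * (q * x) = 2 * x" for x
    by (simp_all add: q_def flip: mult.assoc)
  have tau: "\<tau> = q - 1" by (simp add: q_def \<tau>_def)
  have q: "q > 0" by (simp add: q_def)
  have "\<rho> * \<rho> = 1 + \<tau>\<^sup>2" by (simp add: \<rho>_def)
  then have "\<rho> * \<rho> = 4 - 2 * q" unfolding tau_square by (simp add: tau)
  then have rr: "\<rho> * \<rho> = 4 - 2 * q" "\<rho> * (\<rho> * x) = (4 - 2 * q) * x" for x
    by (simp_all flip: mult.assoc)
  have rho: "\<rho> > 0" by (simp add: \<rho>_def add_pos_nonneg)
  \<comment> \<open>Reciprocals are rationalised so that the final comparison contains no division
    by \<open>q\<close>, \<open>\<rho>\<close> or \<open>\<tau>\<close>.\<close>
  have inv_rho: "1 / \<rho> = \<rho> * (2 + q) / 4"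
    using rho by (simp add: divide_eq_eq algebra_simps qq rr)
  have inv_tau: "1 / \<tau> = q + 1" and inv_q: "1 / q = q / 2" and inv_tau2: "1 / \<tau>\<^sup>2 = 3 + 2 * q"
    and inv_v: "1 / (1 - \<tau>) = (2 + q) / 2"
    using q tau_bounds by (simp_all add: divide_eq_eq, simp_all add: tau power2_eq_square algebra_simps qq)
  have tau5: "\<tau> ^ 5 = 29 * q - 41"
    by (simp add: tau numeral_eq_Suc algebra_simps qq)
  have ln_q: "ln q = l2 / 2"
    by (simp add: q_def l2_def ln_sqrt)
  \<comment> \<open>\<rho>^2 = 2 q \<tau> reduces this logarithm to those of 2 and \<tau>.\<close>
  have ln_rho: "ln \<rho> = 3 / 4 * l2 + l / 2"
  proof -
    have "2 * ln \<rho> = ln (\<rho> * \<rho>)" using rho by (simp add: ln_mult)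
    also have "\<rho> * \<rho> = 2 * (q * \<tau>)" by (simp add: rr tau algebra_simps qq)
    also have "ln \<dots> = l2 + (l2 / 2 + l)"
      using q tau_bounds by (simp add: ln_mult ln_q l2_def l_def)
    finally show ?thesis by simp
  qed
  have arsinh_tau: "arsinh \<tau> = a"
    by (simp add: arsinh_real_def a_def \<rho>_def add.commute)
  have arsinh_inv: "arsinh (1 / \<tau>) = b - l"
  proof -
    have "(1 / \<tau>)\<^sup>2 + 1 = (\<rho> / \<tau>)\<^sup>2"
      using tau_bounds by (simp add: \<rho>_def power_divide field_simps)
    then have "sqrt ((1 / \<tau>)\<^sup>2 + 1) = \<rho> / \<tau>"
      using rho tau_bounds by simp
    then have "arsinh (1 / \<tau>) = ln ((1 + \<rho>) / \<tau>)"
      by (simp add: arsinh_real_def add_divide_distrib)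
    then show ?thesis
      using rho tau_bounds by (simp add: ln_div b_def l_def)
  qed
  have arsinh_one: "arsinh 1 = - l"
  proof -
    have "arsinh 1 = ln (1 / \<tau>)"
      by (simp add: arsinh_real_def inv_tau q_def add.commute)
    then show ?thesis
      using tau_bounds by (simp add: ln_div l_def)
  qed
  have r8: "(1 - \<tau>) / (1 + \<tau>) = \<tau>" "(1 + \<tau>) / (1 - \<tau>) = 1 / \<tau>"
    using q tau_bounds by (simp_all add: divide_eq_eq eq_divide_eq, simp_all add: tau algebra_simps qq)
  have A_tau: "inv_cube_primitive \<tau> = \<rho> * (q / 8 - 1 / 4) - a * q / 8"
  proof -
    have inv_w: "1 / (1 + \<tau>) = q / 2" by (simp add: tau inv_q)
    then have "inv_cube_primitive \<tau> = \<rho> * (q / 2 / 4 - (q / 2)\<^sup>2 / 2) - a / 4 * (1 / q)"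
      unfolding inv_cube_primitive_def r8 arsinh_tau inv_w q_def[symmetric] \<rho>_def[symmetric] by simp
    then show ?thesis
      unfolding inv_q by (simp add: power2_eq_square algebra_simps qq)
  qed
  have A_uminus_tau: "inv_cube_primitive (- \<tau>) = - \<rho> * (4 + 3 * q) / 8 - (b - l) * q / 8"
  proof -
    have signs: "1 + (- \<tau>)\<^sup>2 = 1 + \<tau>\<^sup>2" "1 + - \<tau> = 1 - \<tau>" "1 - - \<tau> = 1 + \<tau>" by simp_all
    have "inv_cube_primitive (- \<tau>) = \<rho> * ((2 + q) / 2 / 4 - ((2 + q) / 2)\<^sup>2 / 2) - (b - l) / 4 * (1 / q)"
      unfolding inv_cube_primitive_def signs r8 arsinh_inv inv_v q_def[symmetric] \<rho>_def[symmetric] by simp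
    then show ?thesis
      unfolding inv_q by (simp add: power2_eq_square field_simps qq)
  qed
  have A_zero: "inv_cube_primitive 0 = - 1 / 4 + l * q / 8"
  proof -
    have "inv_cube_primitive 0 = - 1 / 4 + l / 4 * (1 / q)"
      unfolding inv_cube_primitive_def by (simp add: arsinh_one q_def)
    then show ?thesis
      unfolding inv_q by simp
  qed
  have D: "energy_primitive \<tau> - energy_primitive 0 =
      (5 * q - 3) * ((q - 1) * \<rho> + a) / 2 - \<rho> * (4 - 2 * q)
      - (\<rho> * (q / 8 - 1 / 4) - a * q / 8) + (29 * q - 41) * (- \<rho> * (4 + 3 * q) / 8 - (b - l) * q / 8)
      - (- 1 - (- 1 / 4 + l * q / 8) + (29 * q - 41) * (- 1 / 4 + l * q / 8))"
  proof -
    have "sqrt (1 + \<tau>\<^sup>2) ^ 3 = \<rho> * (4 - 2 * q)"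
      by (simp add: power3_eq_cube rr flip: \<rho>_def)
    moreover have "5 * \<tau> + 2 = 5 * q - 3" by (simp add: tau)
    ultimately show ?thesis
      unfolding energy_primitive_def A_tau A_uminus_tau A_zero minus_zero tau5 arsinh_tau
      by (simp add: A_zero flip: \<rho>_def tau)
  qed
  \<comment> \<open>The nested roots sqrt(2 - q) and sqrt(2 + q) are 2 sin(pi/8) = 2 \<tau>/\<rho>
    and 2 cos(pi/8) = 2/\<rho>.\<close>
  have sqrt_minus: "sqrt (2 - q) = q * \<rho> / 2"
    using q rho by (intro real_sqrt_unique) (simp_all add: power2_eq_square field_simps qq rr)
  have sqrt_plus: "sqrt (2 + q) = \<rho> * (2 + q) / 2"
    using q rho by (intro real_sqrt_unique) (simp_all add: power2_eq_square field_simps qq rr)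
  have ln_plus: "ln (2 + q) = l2 / 2 - l"
  proof -
    have "2 + q = q * (1 / \<tau>)" by (simp add: inv_tau algebra_simps qq)
    then show ?thesis using q tau_bounds by (simp add: ln_mult ln_div ln_q l_def)
  qed
  have ln_minus: "ln (2 - q) = l2 / 2 + l"
  proof -
    have "2 - q = q * \<tau>" by (simp add: tau algebra_simps qq)
    then show ?thesis using q tau_bounds by (simp add: ln_mult ln_q l_def)
  qed
  have ln_prod: "ln (2 * (x * (1 / \<rho>))) = l2 / 4 + ln x - l / 2" if "x > 0" for x
    using that rho by (simp add: ln_mult ln_div ln_rho flip: l2_def)
  \<comment> \<open>2 + 2/\<rho> = 2 (1 + \<rho>)/\<rho>; in the companion below, 2 + 2
    \<tau>/\<rho> = 2 (\<tau> + \<rho>)/\<rho>. So the arguments of \<open>a\<close> and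
    \<open>b\<close> reappear.\<close>
  have ln_sqrt_plus: "ln (2 + \<rho> * (2 + q) / 2) = l2 / 4 + b - l / 2"
  proof -
    have "2 + \<rho> * (2 + q) / 2 = 2 * ((1 + \<rho>) * (1 / \<rho>))"
      unfolding distrib_right inv_rho by (simp add: field_simps qq rr)
    then show ?thesis
      using ln_prod[of "1 + \<rho>"] rho by (simp only: b_def)
  qed
  have ln_sqrt_minus: "ln (2 + q * \<rho> / 2) = l2 / 4 + a - l / 2"
  proof -
    have "2 + q * \<rho> / 2 = 2 * ((\<tau> + \<rho>) * (1 / \<rho>))"
      unfolding distrib_right inv_rho by (simp add: tau field_simps qq rr)
    then show ?thesis
      using ln_prod[of "\<tau> + \<rho>"] rho tau_bounds by (simp only: a_def)
  qed
  have mean: "mean_distance (regular_polygon 8 r c \<theta>) / r =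
      \<rho> * (2 + q) / 4 * (2 * (energy_primitive \<tau> - energy_primitive 0) / 15 * (3 + 2 * q))"
    unfolding mean_distance_regular_octagon[OF assms] cos_pi_eighth
    unfolding inv_rho[symmetric] inv_tau2[symmetric] by (simp add: \<rho>_def)
  show ?thesis
    \<comment> \<open>What remains is an identity between coefficients; those of pi and
      \<open>l2\<close> vanish.\<close>
    unfolding q_def[symmetric] mean sqrt_minus sqrt_plus ln_plus ln_minus ln_sqrt_plus ln_sqrt_minus D
    by (simp add: algebra_simps qq rr add_divide_distrib diff_divide_distrib)
qed

end
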